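(* Let $R=\mathbf{C}[\xi_1,\xi_2,\ldots]$, and let $\mathfrak{p}=\mathfrak{P}(\lambda,e;Z)$ and $\mathfrak{q}=\mathfrak{P}(\mu,d;Y)$ be $\mathfrak{S}$-primes of $R$, where $\lambda=(\lambda_1,\ldots,\lambda_r)$ and $\mu=(\mu_1,\ldots,\mu_s)$ are $\infty$-partitions, $e$ and $d$ are reduced weight vectors for $\lambda$ and $\mu$, and $Z\subset\mathbf{U}^r$, $Y\subset\mathbf{U}^s$ are irreducible Zariski closed subsets. Then $\mathfrak{p}\subset\mathfrak{q}$ if and only if there exist a subset $\mathcal{E}\subset\{1,\ldots,r\}$ and a function $\phi\colon\mathcal{E}\to\{1,\ldots,s\}$ such that, writing $\mathcal{E}_\beta=\{\alpha\in\mathcal{E}\mid\phi(\alpha)=\beta\}$, the following hold: (1) for every $1\le\beta\le s$ we have $\mu_\beta\le\sum_{\alpha\in\mathcal{E}_\beta}\lambda_\alpha$; (2) for every $1\le\beta\le s$ with $\mu_\beta=\infty$ we have $d_\beta\le\sum_{\alpha\in\mathcal{E}_\beta,\ \lambda_\alpha=\infty}e_\alpha$; (3) letting $i\colon\mathbf{A}^s\to\mathbf{A}^{\mathcal{E}}$ be the multi-diagonal map $(y_\beta)_\beta\mapsto(y_{\phi(\alpha)})_{\alpha\in\mathcal{E}}$ and $p\colon\mathbf{A}^r\to\mathbf{A}^{\mathcal{E}}$ the projection $(z_\alpha)_\alpha\mapsto(z_\alpha)_{\alpha\in\mathcal{E}}$, we have $Y\subset i^{-1}(\overline{p(Z)})$,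 where the bar denotes Zariski closure in $\mathbf{A}^{\mathcal{E}}$.
   Context: $[\infty]=\{1,2,3,\ldots\}$ and $\mathfrak{S}=\bigcup_{n\ge 1}\mathfrak{S}_n$ is the group of permutations of $[\infty]$ moving only finitely many elements; it acts on $R$ by permuting the variables. An $\mathfrak{S}$-ideal is an $\mathfrak{S}$-stable ideal of $R$. An $\mathfrak{S}$-ideal $\mathfrak{p}\ne R$ is $\mathfrak{S}$-prime if for all $\mathfrak{S}$-ideals $\mathfrak{a},\mathfrak{b}$, $\mathfrak{a}\mathfrak{b}\subset\mathfrak{p}$ implies $\mathfrak{a}\subset\mathfrak{p}$ or $\mathfrak{b}\subset\mathfrak{p}$. An $\infty$-partition is a finite tuple $\lambda=(\lambda_1,\ldots,\lambda_r)$ with $\lambda_i\in\{1,2,\ldots\}\cup\{\infty\}$, $\lambda_i\ge\lambda_{i+1}$ and $\lambda_1=\infty$. A weight vector is a tuple $e=(e_1,\ldots,e_r)$ of positive integers; it is ($\lambda$-)reduced if $e_i=1$ whenever $\lambda_i$ is finite. For a finite set $\mathcal{E}$, $\mathbf{A}^{\mathcal{E}}$ is complex affine space with coordinates indexed by $\mathcal{E}$. $\mathbf{U}^r\subset\mathbf{A}^r$ is the open subset where all coordinates are distinct. A partition of $[\infty]$ of type $\lambda$ is a tuple $\mathcal{U}=(U_1,\ldots,U_r)$ of disjoint non-empty subsets of $[\infty]$ with union $[\infty]$ and $\#U_j=\lambda_j$; $\pi\colon[\infty]\to\{1,\ldots,r\}$ is defined by $i\in U_{\pi(i)}$. For $Z\subset\mathbf{U}^r$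 closed, $\mathfrak{X}_{[\mathcal{U}]}(Z)$ is the set of points $x=(x_i)_{i\ge1}$, $x_i\in\mathbf{C}$, for which there is a $\mathbf{C}$-point $z=(z_1,\ldots,z_r)$ of $Z$ with $x_i=z_{\pi(i)}$ for all $i$. $\mathfrak{P}(\lambda,e;Z)$ is the $\mathfrak{S}$-ideal of all $f\in R$ such that for every partition $\mathcal{U}$ of $[\infty]$ of type $\lambda$ and every $x\in\mathfrak{X}_{[\mathcal{U}]}(Z)$ one has $(\partial_{i_1}^{k_1}\cdots\partial_{i_m}^{k_m}f)(x)=0$ for every $m\ge0$, all distinct indices $i_1,\ldots,i_m\in[\infty]$ and all integers $0\le k_j<e_{\pi(i_j)}$, where $\partial_i=\partial/\partial\xi_i$. *)

theory Defs
  imports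
    "HOL-Analysis.Analysis"
    "HOL-Combinatorics.Permutations"
    "HOL-Library.Extended_Nat"
    "HOL-Library.Poly_Mapping"
begin

section \<open>The polynomial ring in countably many variables\<close>

text \<open>
  Polynomials are finitely supported functions from monomials to coefficients, and a
  monomial is a finitely supported exponent function; the ring structure is the
  convolution product of \<^theory>\<open>HOL-Library.Poly_Mapping\<close>.  All indices count from
  \<open>0\<close>: the set \<open>[\<infinity>] = {1, 2, \<dots>}\<close> is represented by the type \<^typ>\<open>nat\<close>, and
  \<open>{1, \<dots>, r}\<close> by \<open>{..<r}\<close>.
\<close>

type_synonym cpoly = "(nat \<Rightarrow>\<^sub>0 nat) \<Rightarrow>\<^sub>0 complex"

definition Const :: "complex \<Rightarrow> cpoly" where
  "Const c = Poly_Mapping.single 0 c"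

definition Var :: "nat \<Rightarrow> cpoly" where
  "Var i = Poly_Mapping.single (Poly_Mapping.single i 1) 1"

definition subst_poly ::
    "(complex \<Rightarrow> 'b::comm_semiring_1) \<Rightarrow> (nat \<Rightarrow> 'b) \<Rightarrow> cpoly \<Rightarrow> 'b" where
  "subst_poly h v f =
     (\<Sum>m\<in>Poly_Mapping.keys f. h (Poly_Mapping.lookup f m) *
        (\<Prod>i\<in>Poly_Mapping.keys m. v i ^ Poly_Mapping.lookup m i))"

definition eval_poly :: "(nat \<Rightarrow> complex) \<Rightarrow> cpoly \<Rightarrow> complex" where
  "eval_poly x f = subst_poly (\<lambda>c. c) x f"

definition perm_act :: "(nat \<Rightarrow> nat) \<Rightarrow> cpoly \<Rightarrow> cpoly" where
  "perm_act \<sigma> f = subst_poly Const (\<lambda>i. Var (\<sigma> i)) f"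

text \<open>
  The subtraction of exponents below is truncated, but a monomial not involving the
  variable \<open>i\<close> gets the coefficient \<open>0\<close>.
\<close>

definition partial_deriv :: "nat \<Rightarrow> cpoly \<Rightarrow> cpoly" where
  "partial_deriv i f =
     (\<Sum>m\<in>Poly_Mapping.keys f.
        Poly_Mapping.single (m - Poly_Mapping.single i 1)
          (Poly_Mapping.lookup f m * of_nat (Poly_Mapping.lookup m i)))"

text \<open>
  \<open>mixed_deriv [(i\<^sub>1, k\<^sub>1), \<dots>, (i\<^sub>m, k\<^sub>m)]\<close> is the operator
  \<open>\<partial>\<^bsub>i\<^sub>1\<^esub>\<^bsup>k\<^sub>1\<^esup> \<cdots> \<partial>\<^bsub>i\<^sub>m\<^esub>\<^bsup>k\<^sub>m\<^esup>\<close>.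
\<close>

definition mixed_deriv :: "(nat \<times> nat) list \<Rightarrow> cpoly \<Rightarrow> cpoly" where
  "mixed_deriv iks f = foldr (\<lambda>(i, k). partial_deriv i ^^ k) iks f"


section \<open>Ideals stable under finitary permutations\<close>

text \<open>
  An ideal is a submodule of the ring regarded as a module over itself.  The predicate
  \<^const>\<open>permutation\<close> singles out the bijections with finite support.
\<close>

definition is_ideal :: "'a::comm_ring_1 set \<Rightarrow> bool" where
  "is_ideal I \<longleftrightarrow> module.subspace (*) I"

definition ideal_product :: "'a::comm_ring_1 set \<Rightarrow> 'a set \<Rightarrow> 'a set" where
  "ideal_product I J = module.span (*) {f * g | f g. f \<in> I \<and> g \<in> J}"

lemma module_mult: "module ((*) :: 'a::comm_ring_1 \<Rightarrow> 'a \<Rightarrow> 'a)"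
  by unfold_locales (simp_all add: algebra_simps)

lemma is_ideal_iff:
  "is_ideal I \<longleftrightarrow>
     0 \<in> I \<and> (\<forall>f\<in>I. \<forall>g\<in>I. f + g \<in> I) \<and> (\<forall>c. \<forall>f\<in>I. c * f \<in> I)"
  unfolding is_ideal_def by (rule module.subspace_def[OF module_mult])

definition S_ideal :: "cpoly set \<Rightarrow> bool" where
  "S_ideal I \<longleftrightarrow> is_ideal I \<and> (\<forall>\<sigma>. permutation \<sigma> \<longrightarrow> (\<forall>f\<in>I. perm_act \<sigma> f \<in> I))"

definition S_prime :: "cpoly set \<Rightarrow> bool" where
  "S_prime P \<longleftrightarrow> S_ideal P \<and> P \<noteq> UNIV \<and>
     (\<forall>I J. S_ideal I \<longrightarrow> S_ideal J \<longrightarrow> ideal_product I J \<subseteq> P \<longrightarrow> I \<subseteq> P \<or> J \<subseteq> P)"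


section \<open>Affine spaces and the Zariski topology\<close>

text \<open>
  The complex points of the affine space with coordinates indexed by \<open>E\<close> are the functions
  on \<open>E\<close>, made total by the value \<^const>\<open>undefined\<close> outside \<open>E\<close>.
\<close>

definition affine_space :: "nat set \<Rightarrow> (nat \<Rightarrow> complex) set" where
  "affine_space E = E \<rightarrow>\<^sub>E UNIV"

definition polys_in :: "nat set \<Rightarrow> cpoly set" where
  "polys_in E = {f. \<forall>m\<in>Poly_Mapping.keys f. Poly_Mapping.keys m \<subseteq> E}"

definition zero_locus :: "nat set \<Rightarrow> cpoly set \<Rightarrow> (nat \<Rightarrow> complex) set" where
  "zero_locus E F = {x \<in> affine_space E. \<forall>f\<in>F. eval_poly x f = 0}"

definition zariski :: "nat set \<Rightarrow> (nat \<Rightarrow> complex) topology" where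
  "zariski E = topology (\<lambda>U. \<exists>F\<subseteq>polys_in E. U = affine_space E - zero_locus E F)"

definition irreducible_space :: "'a topology \<Rightarrow> bool" where
  "irreducible_space X \<longleftrightarrow> topspace X \<noteq> {} \<and>
     (\<forall>A B. closedin X A \<longrightarrow> closedin X B \<longrightarrow> A \<union> B = topspace X \<longrightarrow>
        A = topspace X \<or> B = topspace X)"

definition distinct_locus :: "nat \<Rightarrow> (nat \<Rightarrow> complex) set" where
  "distinct_locus r = {x \<in> affine_space {..<r}. inj_on x {..<r}}"

definition irreducible_closed_in_distinct_locus :: "nat \<Rightarrow> (nat \<Rightarrow> complex) set \<Rightarrow> bool" where
  "irreducible_closed_in_distinct_locus r Z \<longleftrightarrow>
     closedin (subtopology (zariski {..<r}) (distinct_locus r)) Z \<and>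
     irreducible_space (subtopology (zariski {..<r}) Z)"

text \<open>The sets in \<^const>\<open>zariski\<close> do form a topology.\<close>

lemma eval_poly_superset:
  assumes "finite A" "Poly_Mapping.keys f \<subseteq> A"
  shows "eval_poly x f = (\<Sum>m\<in>A. Poly_Mapping.lookup f m *
           (\<Prod>i\<in>Poly_Mapping.keys m. x i ^ Poly_Mapping.lookup m i))"
  unfolding eval_poly_def subst_poly_def
  by (rule sum.mono_neutral_left) (use assms in \<open>auto simp: in_keys_iff\<close>)

lemma eval_poly_0 [simp]: "eval_poly x 0 = 0"
  by (simp add: eval_poly_def subst_poly_def)

lemma eval_poly_1 [simp]: "eval_poly x 1 = 1"
  by (simp add: eval_poly_def subst_poly_def lookup_one)

lemma eval_poly_add: "eval_poly x (f + g) = eval_poly x f + eval_poly x g"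
proof -
  let ?A = "Poly_Mapping.keys f \<union> Poly_Mapping.keys g"
  have "Poly_Mapping.keys (f + g) \<subseteq> ?A" by (rule Poly_Mapping.keys_add)
  then show ?thesis
    by (simp add: eval_poly_superset[of ?A] lookup_add distrib_right sum.distrib)
qed

lemma eval_poly_sum: "eval_poly x (sum h A) = (\<Sum>a\<in>A. eval_poly x (h a))"
  by (induction A rule: infinite_finite_induct) (simp_all add: eval_poly_add)

lemma monomial_value_add:
  fixes m n :: "nat \<Rightarrow>\<^sub>0 nat" and x :: "nat \<Rightarrow> complex"
  shows "(\<Prod>i\<in>Poly_Mapping.keys (m + n). x i ^ Poly_Mapping.lookup (m + n) i) =
    (\<Prod>i\<in>Poly_Mapping.keys m. x i ^ Poly_Mapping.lookup m i) *
    (\<Prod>i\<in>Poly_Mapping.keys n. x i ^ Poly_Mapping.lookup n i)"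
proof -
  let ?A = "Poly_Mapping.keys m \<union> Poly_Mapping.keys n"
  have *: "(\<Prod>i\<in>Poly_Mapping.keys k. x i ^ Poly_Mapping.lookup k i) =
      (\<Prod>i\<in>?A. x i ^ Poly_Mapping.lookup k i)"
    if "Poly_Mapping.keys k \<subseteq> ?A" for k
    by (rule prod.mono_neutral_left) (use that in \<open>auto simp: in_keys_iff\<close>)
  show ?thesis
    unfolding *[OF Poly_Mapping.keys_add] *[OF Un_upper1] *[OF Un_upper2]
    by (simp add: lookup_add power_add prod.distrib)
qed

lemma eval_poly_single:
  "eval_poly x (Poly_Mapping.single m c) =
     c * (\<Prod>i\<in>Poly_Mapping.keys m. x i ^ Poly_Mapping.lookup m i)"
  by (simp add: eval_poly_def subst_poly_def)

lemma cpoly_sum_single: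
  "f = (\<Sum>m\<in>Poly_Mapping.keys f. Poly_Mapping.single m (Poly_Mapping.lookup f m))"
  for f :: cpoly
  by (rule poly_mapping_eqI) (auto simp: lookup_sum lookup_single when_def in_keys_iff)

lemma eval_poly_mult: "eval_poly x (f * g) = eval_poly x f * eval_poly x g"
proof -
  let ?s = "\<lambda>f m. Poly_Mapping.single m (Poly_Mapping.lookup f m) :: cpoly"
  have "f * g = (\<Sum>m\<in>Poly_Mapping.keys f. ?s f m) * (\<Sum>n\<in>Poly_Mapping.keys g. ?s g n)"
    using cpoly_sum_single[of f] cpoly_sum_single[of g] by simp
  also have "\<dots> = (\<Sum>m\<in>Poly_Mapping.keys f. \<Sum>n\<in>Poly_Mapping.keys g. ?s f m * ?s g n)"
    by (simp add: sum_product)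
  finally have "eval_poly x (f * g) =
      (\<Sum>m\<in>Poly_Mapping.keys f. \<Sum>n\<in>Poly_Mapping.keys g.
         eval_poly x (?s f m) * eval_poly x (?s g n))"
    by (simp add: eval_poly_sum mult_single eval_poly_single monomial_value_add ac_simps)
  also have "\<dots> = (\<Sum>m\<in>Poly_Mapping.keys f. eval_poly x (?s f m)) *
      (\<Sum>n\<in>Poly_Mapping.keys g. eval_poly x (?s g n))"
    by (simp add: sum_product)
  also have "\<dots> = eval_poly x f * eval_poly x g"
    by (simp flip: eval_poly_sum cpoly_sum_single)
  finally show ?thesis .
qed

lemma polys_in_mult: "f * g \<in> polys_in E" if "f \<in> polys_in E" "g \<in> polys_in E"
proof -
  have "Poly_Mapping.keys m \<subseteq> E" if "m \<in> Poly_Mapping.keys (f * g)" for m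
  proof -
    from that Poly_Mapping.keys_mult[of f g] obtain a b
      where "m = a + b" "a \<in> Poly_Mapping.keys f" "b \<in> Poly_Mapping.keys g" by blast
    with \<open>f \<in> polys_in E\<close> \<open>g \<in> polys_in E\<close> Poly_Mapping.keys_add[of a b] show ?thesis
      unfolding polys_in_def by blast
  qed
  then show ?thesis by (simp add: polys_in_def)
qed

lemma istopology_zariski:
  "istopology (\<lambda>U. \<exists>F\<subseteq>polys_in E. U = affine_space E - zero_locus E F)"
  unfolding istopology_def
proof (intro conjI allI impI)
  fix S T
  assume "\<exists>F\<subseteq>polys_in E. S = affine_space E - zero_locus E F"
    and "\<exists>F\<subseteq>polys_in E. T = affine_space E - zero_locus E F"
  then obtain F G where F: "F \<subseteq> polys_in E" "S = affine_space E - zero_locus E F"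
    and G: "G \<subseteq> polys_in E" "T = affine_space E - zero_locus E G" by blast
  let ?H = "{f * g | f g. f \<in> F \<and> g \<in> G}"
  have "?H \<subseteq> polys_in E" using F(1) G(1) polys_in_mult by blast
  moreover have "zero_locus E ?H = zero_locus E F \<union> zero_locus E G"
    unfolding zero_locus_def by (fastforce simp: eval_poly_mult)
  ultimately show "\<exists>F\<subseteq>polys_in E. S \<inter> T = affine_space E - zero_locus E F"
    using F(2) G(2) by (intro exI[of _ ?H]) blast
next
  fix \<K>
  assume "\<forall>K\<in>\<K>. \<exists>F\<subseteq>polys_in E. K = affine_space E - zero_locus E F"
  then obtain F where F: "\<And>K. K \<in> \<K> \<Longrightarrow> F K \<subseteq> polys_in E"
    "\<And>K. K \<in> \<K> \<Longrightarrow> K = affine_space E - zero_locus E (F K)" by metis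
  have "\<Union>\<K> = (\<Union>K\<in>\<K>. affine_space E - zero_locus E (F K))"
    using F(2) by auto
  also have "\<dots> = affine_space E - zero_locus E (\<Union>K\<in>\<K>. F K)"
    unfolding zero_locus_def by auto
  finally show "\<exists>F\<subseteq>polys_in E. \<Union>\<K> = affine_space E - zero_locus E F"
    using F(1) by (intro exI[of _ "\<Union>K\<in>\<K>. F K"]) auto
qed

lemma topspace_zariski [simp]: "topspace (zariski E) = affine_space E"
proof -
  have "affine_space E = affine_space E - zero_locus E {1}"
    by (auto simp: zero_locus_def)
  moreover have "{1} \<subseteq> polys_in E"
    by (simp add: polys_in_def)
  ultimately show ?thesis
    unfolding topspace_def zariski_def topology_inverse'[OF istopology_zariski] by blast
qed

lemma closedin_zariski:
  "closedin (zariski E) C \<longleftrightarrow> (\<exists>F\<subseteq>polys_in E. C = zero_locus E F)"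
proof -
  have "zero_locus E F \<subseteq> affine_space E" for F
    by (auto simp: zero_locus_def)
  then show ?thesis
    unfolding closedin_def topspace_zariski
    unfolding zariski_def topology_inverse'[OF istopology_zariski]
    by (metis Diff_subset double_diff subset_refl)
qed


section \<open>Infinity-partitions and the ideals attached to them\<close>

definition infinity_partition :: "enat list \<Rightarrow> bool" where
  "infinity_partition lam \<longleftrightarrow>
     lam \<noteq> [] \<and> hd lam = \<infinity> \<and> sorted_wrt (\<ge>) lam \<and> (\<forall>l\<in>set lam. l \<noteq> 0)"

definition weight_vector :: "enat list \<Rightarrow> nat list \<Rightarrow> bool" where
  "weight_vector lam e \<longleftrightarrow> length e = length lam \<and> (\<forall>k\<in>set e. 0 < k)"

definition reduced_weight :: "enat list \<Rightarrow> nat list \<Rightarrow> bool" where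
  "reduced_weight lam e \<longleftrightarrow> weight_vector lam e \<and>
     (\<forall>j<length lam. lam ! j \<noteq> \<infinity> \<longrightarrow> e ! j = 1)"

definition ecard :: "'a set \<Rightarrow> enat" where
  "ecard A = (if finite A then enat (card A) else \<infinity>)"

definition partition_of_type :: "enat list \<Rightarrow> nat set list \<Rightarrow> bool" where
  "partition_of_type lam U \<longleftrightarrow> length U = length lam \<and>
     (\<forall>j<length U. U ! j \<noteq> {} \<and> ecard (U ! j) = lam ! j) \<and>
     (\<forall>j<length U. \<forall>k<length U. j \<noteq> k \<longrightarrow> U ! j \<inter> U ! k = {}) \<and>
     \<Union>(set U) = UNIV"

definition part_index :: "nat set list \<Rightarrow> nat \<Rightarrow> nat" where
  "part_index U i = (THE j. j < length U \<and> i \<in> U ! j)"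

definition point_set :: "nat set list \<Rightarrow> (nat \<Rightarrow> complex) set \<Rightarrow> (nat \<Rightarrow> complex) set" where
  "point_set U Z = {x. \<exists>z\<in>Z. \<forall>i. x i = z (part_index U i)}"

definition PP :: "enat list \<Rightarrow> nat list \<Rightarrow> (nat \<Rightarrow> complex) set \<Rightarrow> cpoly set" where
  "PP lam e Z =
     {f. \<forall>U. partition_of_type lam U \<longrightarrow> (\<forall>x\<in>point_set U Z.
           \<forall>iks. distinct (map fst iks) \<longrightarrow>
             (\<forall>(i, k)\<in>set iks. k < e ! part_index U i) \<longrightarrow>
             eval_poly x (mixed_deriv iks f) = 0)}"


section \<open>Multi-diagonal maps and projections\<close>

definition multidiagonal ::
    "nat set \<Rightarrow> (nat \<Rightarrow> nat) \<Rightarrow> (nat \<Rightarrow> complex) \<Rightarrow> (nat \<Rightarrow> complex)" where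
  "multidiagonal E \<phi> y = (\<lambda>\<alpha>\<in>E. y (\<phi> \<alpha>))"

definition coord_proj :: "nat set \<Rightarrow> (nat \<Rightarrow> complex) \<Rightarrow> (nat \<Rightarrow> complex)" where
  "coord_proj E z = restrict z E"

end

theory Submission
  imports Defs "HOL-Computational_Algebra.Formal_Power_Series"
begin

text \<open>
  The polynomials vanishing to the orders prescribed by \<^const>\<open>PP\<close> are those killed by all
  products of Taylor functionals \<open>\<partial>\<^sup>k / k!\<close> at \<open>z (\<pi> i)\<close> with \<open>k < e ! \<pi> i\<close>, one factor for each
  variable \<open>i\<close>.  For a polynomial in finitely many variables, the map \<open>\<pi>\<close> from variables to
  parts can be any map on those variables whose fibres over the finite parts are not too large
  (\<open>PP_mem_iff\<close>).

  Given \<open>E\<close> and \<open>\<phi>\<close>, the ideal of \<open>Z\<close> is contained in that of \<open>Y\<close> because Taylor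
  functionals of different nodes that move together combine to Taylor functionals of
  higher order: the divided difference with nodes \<open>z \<alpha>\<close>, each repeated at most \<open>e ! \<alpha>\<close> times, is a
  combination of Taylor functionals of orders less than \<open>e ! \<alpha>\<close>, is polynomial in the nodes, and
  becomes a Taylor functional of order less than \<open>\<Sum>\<alpha>. e ! \<alpha>\<close> when all nodes coincide
  (\<open>divided_difference_lincomb\<close>, \<open>divided_difference_replicate\<close>).  A polynomial of the
  nodes that vanishes on the projection of \<open>Z\<close> vanishes on its closure, hence at
  the multi-diagonal image of \<open>Y\<close> (\<open>PP_subset_PP\<close>).

  Conversely, let \<open>y \<in> Y\<close> be a point at which no \<open>E\<close> and \<open>\<phi>\<close> are suitable.  Finitely many
  variables are distributed over the parts of \<open>mu\<close> by a map \<open>\<rho>\<close>, with sufficiently many variables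
  in the infinite parts.  Let \<open>\<pi>\<close> be a distribution of the same variables over the parts of
  \<open>lam\<close>.  If the infinite parts of \<open>lam\<close> that meet an infinite part \<open>\<beta>\<close> of \<open>mu\<close> have total weight
  less than \<open>d ! \<beta>\<close>, then a Vandermonde determinant in \<open>d ! \<beta>\<close> variables of \<open>\<beta>\<close>, all of them in
  infinite parts of \<open>lam\<close>, is killed by the functionals of \<open>\<pi>\<close>, since two of its rows agree.
  Still, each variable occurs in it with exponents less than \<open>d ! \<beta>\<close> only, so it is not in the
  ideal at \<open>y\<close> (\<open>prodfun_alternant_eq_0\<close>, \<open>taylor_coeff_alternant\<close>).  Otherwise, the
  point of \<open>y\<close> for \<open>\<rho>\<close> is not in the closure of the points of \<open>Z\<close> for \<open>\<pi>\<close>, and there is a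
  polynomial vanishing on the latter but not at the former (\<open>separating_polynomial\<close>).  A product of
  determinants and of powers of separating polynomials, over all \<open>\<pi>\<close>, is then in the ideal of
  \<open>Z\<close> but not in that of \<open>Y\<close> (\<open>PP_subset_imp_compatible\<close>).  So every point of \<open>Y\<close>
  satisfies one of finitely many closed conditions, and since \<open>Y\<close> is irreducible, one of them
  holds on all of \<open>Y\<close>.
\<close>

section \<open>Products of univariate functionals\<close>

text \<open>
  A sequence \<open>l i :: nat \<Rightarrow> complex\<close> is regarded as the linear functional on polynomials in
  the single variable \<open>i\<close> that sends the \<open>j\<close>-th power of the variable to \<open>l i j\<close>.  Then
  \<open>prodfun B l\<close> is the tensor product of these functionals over \<open>i \<in> B\<close>.  Variables outside
  \<open>B\<close> are ignored, that is, set to \<open>1\<close>; the functional is only applied to polynomials in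
  the variables \<open>B\<close>.
\<close>

definition prodfun :: "nat set \<Rightarrow> (nat \<Rightarrow> nat \<Rightarrow> complex) \<Rightarrow> cpoly \<Rightarrow> complex" where
  "prodfun B l f =
     (\<Sum>m\<in>Poly_Mapping.keys f. Poly_Mapping.lookup f m * (\<Prod>i\<in>B. l i (Poly_Mapping.lookup m i)))"

text \<open>
  \<open>taylor k x\<close> is the functional on univariate polynomials that takes the \<open>k\<close>-th Taylor
  coefficient at \<open>x\<close>, i.e. the \<open>k\<close>-th derivative at \<open>x\<close> divided by \<open>k!\<close>.  For \<open>j < k\<close> the
  exponent \<open>j - k\<close> is truncated, but the binomial coefficient vanishes.
\<close>

definition taylor :: "nat \<Rightarrow> complex \<Rightarrow> nat \<Rightarrow> complex" where
  "taylor k x j = of_nat (j choose k) * x ^ (j - k)"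

lemma taylor_at_0 [simp]: "taylor k x 0 = (if k = 0 then 1 else 0)"
  by (simp add: taylor_def)

lemma taylor_0: "taylor 0 x j = x ^ j"
  by (simp add: taylor_def)

lemma prodfun_superset:
  assumes "finite A" "Poly_Mapping.keys f \<subseteq> A"
  shows "prodfun B l f = (\<Sum>m\<in>A. Poly_Mapping.lookup f m *
           (\<Prod>i\<in>B. l i (Poly_Mapping.lookup m i)))"
  unfolding prodfun_def
  by (rule sum.mono_neutral_left) (use assms in \<open>auto simp: in_keys_iff\<close>)

lemma prodfun_0 [simp]: "prodfun B l 0 = 0"
  by (simp add: prodfun_def)

lemma prodfun_add: "prodfun B l (f + g) = prodfun B l f + prodfun B l g"
proof -
  let ?A = "Poly_Mapping.keys f \<union> Poly_Mapping.keys g"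
  have "Poly_Mapping.keys (f + g) \<subseteq> ?A" by (rule Poly_Mapping.keys_add)
  then show ?thesis
    by (simp add: prodfun_superset[of ?A] lookup_add distrib_right sum.distrib)
qed

lemma prodfun_sum: "prodfun B l (sum h A) = (\<Sum>a\<in>A. prodfun B l (h a))"
  by (induction A rule: infinite_finite_induct) (simp_all add: prodfun_add)

lemma prodfun_single:
  "prodfun B l (Poly_Mapping.single m c) = c * (\<Prod>i\<in>B. l i (Poly_Mapping.lookup m i))"
  by (simp add: prodfun_def)

lemma prodfun_cong:
  assumes "\<And>i j. i \<in> B \<Longrightarrow> l i j = l' i j"
  shows "prodfun B l f = prodfun B l' f"
  unfolding prodfun_def using assms by (auto intro!: sum.cong prod.cong)

text \<open>
  Linearity of the product functional in one of its factors.
\<close>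

lemma prodfun_comb:
  assumes "finite B" "a \<in> B" "\<And>j. l a j = u * l1 j + v * l2 j"
  shows "prodfun B l f = u * prodfun B (l(a := l1)) f + v * prodfun B (l(a := l2)) f"
proof -
  have "(\<Prod>i\<in>B. l i (Poly_Mapping.lookup m i)) =
      u * (\<Prod>i\<in>B. (l(a := l1)) i (Poly_Mapping.lookup m i)) +
      v * (\<Prod>i\<in>B. (l(a := l2)) i (Poly_Mapping.lookup m i))" for m
  proof -
    have "(\<Prod>i\<in>B - {a}. (l(a := h)) i (Poly_Mapping.lookup m i)) =
       (\<Prod>i\<in>B - {a}. l i (Poly_Mapping.lookup m i))" for h
      by (rule prod.cong) auto
    then show ?thesis
      using assms by (simp add: prod.remove[of B a] algebra_simps)
  qed
  then show ?thesis
    by (simp add: prodfun_def sum_distrib_left algebra_simps sum.distrib)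
qed

lemma prodfun_mult:
  "prodfun B l (f * g) = (\<Sum>m\<in>Poly_Mapping.keys f. \<Sum>n\<in>Poly_Mapping.keys g.
     Poly_Mapping.lookup f m * Poly_Mapping.lookup g n *
     (\<Prod>i\<in>B. l i (Poly_Mapping.lookup m i + Poly_Mapping.lookup n i)))"
proof -
  let ?s = "\<lambda>f m. Poly_Mapping.single m (Poly_Mapping.lookup f m) :: cpoly"
  have "f * g = (\<Sum>m\<in>Poly_Mapping.keys f. ?s f m) * (\<Sum>n\<in>Poly_Mapping.keys g. ?s g n)"
    using cpoly_sum_single[of f] cpoly_sum_single[of g] by simp
  also have "\<dots> = (\<Sum>m\<in>Poly_Mapping.keys f. \<Sum>n\<in>Poly_Mapping.keys g. ?s f m * ?s g n)"
    by (simp add: sum_product)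
  finally show ?thesis
    by (simp add: prodfun_sum mult_single prodfun_single lookup_add)
qed

lemma polys_inD: "f \<in> polys_in E \<Longrightarrow> m \<in> Poly_Mapping.keys f \<Longrightarrow> i \<notin> E \<Longrightarrow> Poly_Mapping.lookup m i = 0"
  unfolding polys_in_def by (metis (mono_tags, lifting) in_keys_iff mem_Collect_eq subsetD)

lemma polys_in_mono: "A \<subseteq> B \<Longrightarrow> f \<in> polys_in A \<Longrightarrow> f \<in> polys_in B"
  unfolding polys_in_def by auto

lemma polys_in_finite: "\<exists>B. finite B \<and> f \<in> polys_in B"
  by (rule exI[of _ "\<Union>(Poly_Mapping.keys ` Poly_Mapping.keys f)"]) (auto simp: polys_in_def)

lemma polys_in_0 [simp]: "0 \<in> polys_in E"
  by (simp add: polys_in_def)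

lemma polys_in_1 [simp]: "1 \<in> polys_in E"
  by (simp add: polys_in_def)

lemma polys_in_add: "f + g \<in> polys_in E" if "f \<in> polys_in E" "g \<in> polys_in E"
  using that Poly_Mapping.keys_add[of f g] unfolding polys_in_def by blast

lemma polys_in_sum: "(\<And>a. a \<in> A \<Longrightarrow> h a \<in> polys_in E) \<Longrightarrow> sum h A \<in> polys_in E"
  by (induction A rule: infinite_finite_induct) (auto intro: polys_in_add)

lemma polys_in_prod: "(\<And>a. a \<in> A \<Longrightarrow> h a \<in> polys_in E) \<Longrightarrow> prod h A \<in> polys_in E"
  by (induction A rule: infinite_finite_induct) (auto intro: polys_in_mult)

lemma polys_in_power: "h \<in> polys_in E \<Longrightarrow> h ^ n \<in> polys_in E"
  by (induction n) (auto intro: polys_in_mult)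

lemma polys_in_Const: "Const c \<in> polys_in E"
  by (simp add: polys_in_def Const_def)

lemma polys_in_Var: "i \<in> E \<Longrightarrow> Var i \<in> polys_in E"
  by (simp add: polys_in_def Var_def)

lemma eval_poly_Const [simp]: "eval_poly x (Const c) = c"
  by (simp add: Const_def eval_poly_single)

lemma eval_poly_Var [simp]: "eval_poly x (Var i) = x i"
  by (simp add: Var_def eval_poly_single)

lemma eval_poly_prod: "eval_poly x (prod h A) = (\<Prod>a\<in>A. eval_poly x (h a))"
  by (induction A rule: infinite_finite_induct) (simp_all add: eval_poly_mult)

lemma eval_poly_cong:
  assumes "f \<in> polys_in E" "\<And>i. i \<in> E \<Longrightarrow> x i = y i"
  shows "eval_poly x f = eval_poly y f"
proof -
  have "x i = y i" if "m \<in> Poly_Mapping.keys f" "i \<in> Poly_Mapping.keys m" for m i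
    using assms that by (auto simp: polys_in_def)
  then show ?thesis
    unfolding eval_poly_def subst_poly_def by (auto intro!: sum.cong prod.cong)
qed

lemma prodfun_enlarge:
  assumes "finite A" "B \<subseteq> A" "f \<in> polys_in B"
  shows "prodfun A l f = prodfun B l f * (\<Prod>i\<in>A - B. l i 0)"
proof -
  have fin: "finite B" "A = B \<union> (A - B)" using assms finite_subset by auto
  have "(\<Prod>i\<in>A. l i (Poly_Mapping.lookup m i)) =
     (\<Prod>i\<in>B. l i (Poly_Mapping.lookup m i)) * (\<Prod>i\<in>A - B. l i 0)"
    if "m \<in> Poly_Mapping.keys f" for m
  proof -
    have "(\<Prod>i\<in>A - B. l i 0) = (\<Prod>i\<in>A - B. l i (Poly_Mapping.lookup m i))"
      using polys_inD[OF assms(3) that] by (intro prod.cong) auto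
    then show ?thesis
      using prod.subset_diff[OF assms(2,1)] by (metis mult.commute)
  qed
  then show ?thesis
    by (simp add: prodfun_def sum_distrib_right mult.assoc)
qed

lemma eval_poly_prodfun:
  assumes "finite B" "f \<in> polys_in B"
  shows "eval_poly x f = prodfun B (\<lambda>i. taylor 0 (x i)) f"
proof -
  have "(\<Prod>i\<in>Poly_Mapping.keys m. x i ^ Poly_Mapping.lookup m i) =
     (\<Prod>i\<in>B. x i ^ Poly_Mapping.lookup m i)" if "m \<in> Poly_Mapping.keys f" for m
    by (rule prod.mono_neutral_left) (use assms that in \<open>auto simp: polys_in_def in_keys_iff\<close>)
  then show ?thesis
    by (simp add: eval_poly_def subst_poly_def prodfun_def taylor_0)
qed

section \<open>Mixed derivatives\<close>

lemma partial_deriv_superset: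
  assumes "finite A" "Poly_Mapping.keys f \<subseteq> A"
  shows "partial_deriv i f = (\<Sum>m\<in>A. Poly_Mapping.single (m - Poly_Mapping.single i 1)
          (Poly_Mapping.lookup f m * of_nat (Poly_Mapping.lookup m i)))"
  unfolding partial_deriv_def
  by (rule sum.mono_neutral_left) (use assms in \<open>auto simp: in_keys_iff\<close>)

lemma partial_deriv_add: "partial_deriv i (f + g) = partial_deriv i f + partial_deriv i g"
proof -
  let ?A = "Poly_Mapping.keys f \<union> Poly_Mapping.keys g"
  have "Poly_Mapping.keys (f + g) \<subseteq> ?A" by (rule Poly_Mapping.keys_add)
  then show ?thesis
    by (simp add: partial_deriv_superset[of ?A] lookup_add distrib_right sum.distrib single_add)
qed

lemma partial_deriv_0 [simp]: "partial_deriv i 0 = 0"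
  by (simp add: partial_deriv_def)

lemma partial_deriv_single:
  "partial_deriv i (Poly_Mapping.single m c) =
     Poly_Mapping.single (m - Poly_Mapping.single i 1) (c * of_nat (Poly_Mapping.lookup m i))"
  by (simp add: partial_deriv_def)

lemma partial_deriv_funpow_add:
  "(partial_deriv i ^^ k) (f + g) = (partial_deriv i ^^ k) f + (partial_deriv i ^^ k) g"
  by (induction k) (simp_all add: partial_deriv_add)

lemma partial_deriv_funpow_0 [simp]: "(partial_deriv i ^^ k) 0 = 0"
  by (induction k) simp_all

lemma partial_deriv_funpow_single:
  "(partial_deriv i ^^ k) (Poly_Mapping.single m c) =
     Poly_Mapping.single (m - Poly_Mapping.single i k)
       (c * (fact k * of_nat (Poly_Mapping.lookup m i choose k)))"
proof (induction k)
  case (Suc k)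
  have m: "m - Poly_Mapping.single i k - Poly_Mapping.single i 1 = m - Poly_Mapping.single i (Suc k)"
    by (rule poly_mapping_eqI) (simp add: lookup_minus lookup_single when_def)
  have "(j - k) * (j choose k) = Suc k * (j choose Suc k)" for j
    by (metis binomial_absorb_comp binomial_absorption mult.commute)
  then have "of_nat (j choose k) * of_nat (j - k) = (of_nat (Suc k) * of_nat (j choose Suc k) :: complex)" for j
    by (metis mult.commute of_nat_mult)
  then have "fact k * of_nat (j choose k) * of_nat (j - k) =
       (fact (Suc k) * of_nat (j choose Suc k) :: complex)" for j
    by (simp add: mult.assoc mult.left_commute)
  then show ?case
    using Suc m by (simp add: partial_deriv_single lookup_minus mult.assoc mult.left_commute)
qed simp

lemma mixed_deriv_Cons: "mixed_deriv ((i, k) # iks) f = (partial_deriv i ^^ k) (mixed_deriv iks f)"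
  by (simp add: mixed_deriv_def)

lemma mixed_deriv_Nil [simp]: "mixed_deriv [] f = f"
  by (simp add: mixed_deriv_def)

lemma mixed_deriv_add: "mixed_deriv iks (f + g) = mixed_deriv iks f + mixed_deriv iks g"
  by (induction iks) (auto simp: mixed_deriv_Cons partial_deriv_funpow_add)

lemma mixed_deriv_0 [simp]: "mixed_deriv iks 0 = 0"
  by (induction iks) (auto simp: mixed_deriv_Cons)

lemma mixed_deriv_sum: "mixed_deriv iks (sum h A) = (\<Sum>a\<in>A. mixed_deriv iks (h a))"
  by (induction A rule: infinite_finite_induct) (simp_all add: mixed_deriv_add)

text \<open>
  The multi-index of total orders of differentiation in a list of pairs (variable, order).
\<close>

definition orders :: "(nat \<times> nat) list \<Rightarrow> nat \<Rightarrow>\<^sub>0 nat" where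
  "orders iks = (\<Sum>(i, k)\<leftarrow>iks. Poly_Mapping.single i k)"

lemma orders_Cons: "orders ((i, k) # iks) = Poly_Mapping.single i k + orders iks"
  by (simp add: orders_def)

lemma orders_notin: "i \<notin> fst ` set iks \<Longrightarrow> Poly_Mapping.lookup (orders iks) i = 0"
  by (induction iks) (auto simp: orders_Cons lookup_add lookup_single when_def orders_def[of "[]"])

lemma orders_in:
  "distinct (map fst iks) \<Longrightarrow> (i, k) \<in> set iks \<Longrightarrow> Poly_Mapping.lookup (orders iks) i = k"
  by (induction iks) (force simp: orders_Cons lookup_add lookup_single when_def orders_notin)+

lemma mixed_deriv_single:
  assumes "distinct (map fst iks)"
  shows "mixed_deriv iks (Poly_Mapping.single m c) =
     Poly_Mapping.single (m - orders iks)
       (c * (\<Prod>(i, k)\<leftarrow>iks. fact k * of_nat (Poly_Mapping.lookup m i choose k)))"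
  using assms
proof (induction iks)
  case Nil
  then show ?case by (simp add: orders_def)
next
  case (Cons ik iks)
  obtain i k where ik: "ik = (i, k)" by fastforce
  have *: "m - orders iks - Poly_Mapping.single i k = m - orders ((i, k) # iks)"
    by (rule poly_mapping_eqI) (simp add: lookup_minus orders_Cons lookup_add)
  have "mixed_deriv (ik # iks) (Poly_Mapping.single m c) = Poly_Mapping.single (m - orders (ik # iks))
      (c * (\<Prod>(i, k)\<leftarrow>iks. fact k * of_nat (Poly_Mapping.lookup m i choose k)) *
        (fact k * of_nat (Poly_Mapping.lookup m i choose k)))"
    using Cons by (simp add: ik mixed_deriv_Cons partial_deriv_funpow_single * lookup_minus
      orders_notin)
  then show ?case
    by (simp add: ik mult_ac)
qed

text \<open>
  Up to a product of factorials, evaluating a mixed derivative at \<open>x\<close> is applying the product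
  of the Taylor functionals at the coordinates of \<open>x\<close>.
\<close>

lemma eval_mixed_deriv:
  assumes iks: "distinct (map fst iks)" and A: "finite A" "fst ` set iks \<subseteq> A"
    and f: "f \<in> polys_in A"
  shows "eval_poly x (mixed_deriv iks f) = (\<Prod>(i, k)\<leftarrow>iks. fact k) *
     prodfun A (\<lambda>i. taylor (Poly_Mapping.lookup (orders iks) i) (x i)) f"
proof -
  let ?k = "Poly_Mapping.lookup (orders iks)"
  have "eval_poly x (mixed_deriv iks (Poly_Mapping.single m c)) =
      (\<Prod>(i, k)\<leftarrow>iks. fact k) * (c * (\<Prod>i\<in>A. taylor (?k i) (x i) (Poly_Mapping.lookup m i)))"
    if m: "Poly_Mapping.keys m \<subseteq> A" for m c
  proof -
    have 1: "(\<Prod>i\<in>A. of_nat (Poly_Mapping.lookup m i choose ?k i)) =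
        (\<Prod>(i, k)\<leftarrow>iks. (of_nat (Poly_Mapping.lookup m i choose k) :: complex))"
    proof -
      have "(\<Prod>i\<in>A. of_nat (Poly_Mapping.lookup m i choose ?k i)) =
          (\<Prod>i\<in>fst ` set iks. (of_nat (Poly_Mapping.lookup m i choose ?k i) :: complex))"
        by (rule prod.mono_neutral_right) (use A orders_notin in auto)
      also have "\<dots> = prod_list (map (\<lambda>i. of_nat (Poly_Mapping.lookup m i choose ?k i)) (map fst iks))"
        using prod.distinct_set_conv_list[OF iks] by (metis (no_types, lifting) list.set_map)
      also have "\<dots> = (\<Prod>(i, k)\<leftarrow>iks. (of_nat (Poly_Mapping.lookup m i choose k) :: complex))"
        by (auto intro!: arg_cong[where f = prod_list] simp: orders_in[OF iks])
      finally show ?thesis .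
    qed
    have 2: "(\<Prod>i\<in>Poly_Mapping.keys (m - orders iks). x i ^ Poly_Mapping.lookup (m - orders iks) i) =
        (\<Prod>i\<in>A. x i ^ (Poly_Mapping.lookup m i - ?k i))"
    proof -
      have "(\<Prod>i\<in>Poly_Mapping.keys (m - orders iks). x i ^ Poly_Mapping.lookup (m - orders iks) i) =
          (\<Prod>i\<in>A. x i ^ Poly_Mapping.lookup (m - orders iks) i)"
        by (rule prod.mono_neutral_left) (use A m in \<open>auto simp: in_keys_iff lookup_minus\<close>)
      then show ?thesis by (simp add: lookup_minus)
    qed
    have 3: "(\<Prod>(i, k)\<leftarrow>iks. fact k * of_nat (Poly_Mapping.lookup m i choose k)) =
      (\<Prod>(i, k)\<leftarrow>iks. fact k) * (\<Prod>(i, k)\<leftarrow>iks. (of_nat (Poly_Mapping.lookup m i choose k) :: complex))"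
      for iks :: "(nat \<times> nat) list"
      by (induction iks) auto
    show ?thesis
      by (simp add: mixed_deriv_single[OF iks] eval_poly_single 2 3 taylor_def prod.distrib 1)
  qed
  note single = this
  have "eval_poly x (mixed_deriv iks f) = (\<Sum>m\<in>Poly_Mapping.keys f.
      eval_poly x (mixed_deriv iks (Poly_Mapping.single m (Poly_Mapping.lookup f m))))"
    by (subst cpoly_sum_single) (simp add: mixed_deriv_sum eval_poly_sum)
  also have "\<dots> = (\<Sum>m\<in>Poly_Mapping.keys f. (\<Prod>(i, k)\<leftarrow>iks. fact k) *
      (Poly_Mapping.lookup f m * (\<Prod>i\<in>A. taylor (?k i) (x i) (Poly_Mapping.lookup m i))))"
    using f by (intro sum.cong single) (auto simp: polys_in_def)
  finally show ?thesis
    by (simp add: prodfun_def sum_distrib_left)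
qed

section \<open>Membership in terms of finitely many variables\<close>

text \<open>
  The restriction to a set \<open>B\<close> of indices of the map sending an index to its part, for a
  partition of type \<open>lam\<close>.  For finite \<open>B\<close> the bounds on the fibres are the only
  constraint, by the two lemmas \<open>admissible_part_index\<close> and \<open>admissible_extend\<close> below.
\<close>

definition admissible :: "enat list \<Rightarrow> nat set \<Rightarrow> (nat \<Rightarrow> nat) \<Rightarrow> bool" where
  "admissible lam B \<pi> \<longleftrightarrow> \<pi> \<in> B \<rightarrow> {..<length lam} \<and>
     (\<forall>\<alpha><length lam. enat (card {i\<in>B. \<pi> i = \<alpha>}) \<le> lam ! \<alpha>)"

lemma part_index_unique:
  assumes "partition_of_type lam U" "j < length lam" "i \<in> U ! j"
  shows "part_index U i = j"
  unfolding part_index_def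
proof (rule the_equality)
  show "j < length U \<and> i \<in> U ! j" using assms by (simp add: partition_of_type_def)
next
  fix j' assume "j' < length U \<and> i \<in> U ! j'"
  then show "j' = j" using assms unfolding partition_of_type_def by (metis disjoint_iff)
qed

lemma part_index_mem:
  assumes "partition_of_type lam U"
  shows "part_index U i < length lam" "i \<in> U ! part_index U i"
proof -
  have "i \<in> \<Union>(set U)" using assms by (auto simp: partition_of_type_def)
  then obtain j where "j < length lam" "i \<in> U ! j"
    using assms by (auto simp: partition_of_type_def in_set_conv_nth)
  with part_index_unique[OF assms this]
  show "part_index U i < length lam" "i \<in> U ! part_index U i" by auto
qed

lemma ecard_mono: "A \<subseteq> B \<Longrightarrow> ecard A \<le> ecard B"
  by (auto simp: ecard_def card_mono finite_subset)

lemma ecard_Un_disjoint: "A \<inter> B = {} \<Longrightarrow> ecard (A \<union> B) = ecard A + ecard B"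
  by (auto simp: ecard_def card_Un_disjoint)

lemma ecard_vimage_bij:
  assumes "bij_betw g A T" "S \<subseteq> T"
  shows "ecard {i\<in>A. g i \<in> S} = ecard S"
proof -
  have "bij_betw g {i\<in>A. g i \<in> S} S"
    using assms unfolding bij_betw_def by (auto simp: inj_on_def)
  then show ?thesis
    by (simp add: ecard_def bij_betw_finite bij_betw_same_card)
qed

lemma ecard_enat_lessThan: "ecard {j. enat j < n} = n"
proof (cases n)
  case (enat m)
  then have "{j. enat j < n} = {..<m}" by auto
  then show ?thesis using enat by (simp add: ecard_def)
next
  case infinity
  then have "{j. enat j < n} = UNIV" by auto
  then show ?thesis using infinity by (simp add: ecard_def)
qed

lemma ecard_Pair: "ecard (Pair a ` S) = ecard S"
  by (auto simp: ecard_def card_image inj_on_def finite_image_iff)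

lemma admissible_part_index:
  assumes U: "partition_of_type lam U" and B: "finite B"
  shows "admissible lam B (part_index U)"
  unfolding admissible_def
proof (intro conjI allI impI)
  show "part_index U \<in> B \<rightarrow> {..<length lam}"
    using part_index_mem(1)[OF U] by auto
next
  fix \<alpha> assume \<alpha>: "\<alpha> < length lam"
  have "enat (card {i\<in>B. part_index U i = \<alpha>}) = ecard {i\<in>B. part_index U i = \<alpha>}"
    using B by (simp add: ecard_def)
  also have "\<dots> \<le> ecard (U ! \<alpha>)"
    using part_index_mem(2)[OF U] by (intro ecard_mono) auto
  also have "\<dots> = lam ! \<alpha>" using U \<alpha> by (simp add: partition_of_type_def)
  finally show "enat (card {i\<in>B. part_index U i = \<alpha>}) \<le> lam ! \<alpha>" .
qed

lemma admissible_extend: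
  assumes lam: "infinity_partition lam" and B: "finite B" and adm: "admissible lam B \<pi>"
  shows "\<exists>U. partition_of_type lam U \<and> (\<forall>i\<in>B. part_index U i = \<pi> i)"
proof -
  define r where "r = length lam"
  define F where "F \<alpha> = {i\<in>B. \<pi> i = \<alpha>}" for \<alpha>
  have le: "ecard (F \<alpha>) \<le> lam ! \<alpha>" if "\<alpha> < r" for \<alpha>
    using adm that B by (simp add: admissible_def F_def r_def ecard_def)
  define \<delta> where "\<delta> \<alpha> = lam ! \<alpha> - ecard (F \<alpha>)" for \<alpha>
  have \<delta>: "ecard (F \<alpha>) + \<delta> \<alpha> = lam ! \<alpha>" if "\<alpha> < r" for \<alpha>
    using le[OF that] unfolding \<delta>_def by (simp add: F_def B ecard_def) (metis add_diff_cancel_enat le_iff_add enat.distinct(2))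
  have r0: "0 < r" "lam ! 0 = \<infinity>"
    using lam by (auto simp: infinity_partition_def r_def hd_conv_nth)
  \<comment> \<open>\<open>T\<close> has one element for each point still missing from a part; as the part \<open>0\<close> is
    infinite, \<open>T\<close> is countably infinite, hence in bijection with the complement of \<open>B\<close>.\<close>
  define T where "T = (SIGMA \<alpha>:{..<r}. {j. enat j < \<delta> \<alpha>})"
  have "\<delta> 0 = \<infinity>" using r0 by (simp add: \<delta>_def F_def B ecard_def)
  then have "Pair 0 ` UNIV \<subseteq> T" using r0 by (auto simp: T_def)
  moreover have "infinite (range (Pair (0::nat) :: nat \<Rightarrow> _))"
    by (simp add: finite_image_iff inj_on_def)
  ultimately have T: "infinite T" using finite_subset by blast
  have "infinite (- B)" using B by (simp add: finite_compl)
  then have "bij_betw (to_nat_on (- B)) (- B) UNIV" by (intro to_nat_on_infinite) auto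
  moreover have "bij_betw (from_nat_into T) UNIV T"
    using T by (intro bij_betw_from_nat_into) auto
  ultimately obtain g where g: "bij_betw g (- B) T" using bij_betw_trans by blast
  define V where "V \<alpha> = F \<alpha> \<union> {i\<in>- B. g i \<in> Pair \<alpha> ` {j. enat j < \<delta> \<alpha>}}" for \<alpha>
  define U where "U = map V [0..<r]"
  have V: "ecard (V \<alpha>) = lam ! \<alpha>" if "\<alpha> < r" for \<alpha>
  proof -
    have "ecard (V \<alpha>) = ecard (F \<alpha>) + ecard {i\<in>- B. g i \<in> Pair \<alpha> ` {j. enat j < \<delta> \<alpha>}}"
      unfolding V_def by (intro ecard_Un_disjoint) (auto simp: F_def)
    also have "ecard {i\<in>- B. g i \<in> Pair \<alpha> ` {j. enat j < \<delta> \<alpha>}} = \<delta> \<alpha>"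
      using that by (subst ecard_vimage_bij[OF g])
        (auto simp: T_def ecard_Pair ecard_enat_lessThan)
    finally show ?thesis using \<delta>[OF that] by simp
  qed
  have U: "partition_of_type lam U"
    unfolding partition_of_type_def
  proof (intro conjI allI impI)
    show "length U = length lam" by (simp add: U_def r_def)
  next
    fix j assume "j < length U"
    then have j: "j < r" by (simp add: U_def)
    show "ecard (U ! j) = lam ! j" using V[OF j] j by (simp add: U_def)
    moreover have "lam ! j \<noteq> 0"
      using lam j by (auto simp: infinity_partition_def r_def)
    ultimately show "U ! j \<noteq> {}" by (auto simp: ecard_def zero_enat_def)
  next
    fix j k assume "j < length U" "k < length U" "j \<noteq> k"
    then show "U ! j \<inter> U ! k = {}" by (auto simp: U_def V_def F_def)
  next
    have "i \<in> (\<Union>\<alpha><r. V \<alpha>)" for i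
    proof (cases "i \<in> B")
      case True
      then have "\<pi> i < r" using adm by (auto simp: admissible_def r_def)
      then show ?thesis using True by (auto simp: V_def F_def)
    next
      case False
      then have "g i \<in> T" using g by (auto simp: bij_betw_def)
      then show ?thesis using False by (fastforce simp: V_def T_def)
    qed
    then show "\<Union>(set U) = UNIV" by (auto simp: U_def atLeast0LessThan)
  qed
  moreover have "part_index U i = \<pi> i" if "i \<in> B" for i
  proof (rule part_index_unique[OF U])
    show "\<pi> i < length lam" using adm that by (auto simp: admissible_def)
    then show "i \<in> U ! \<pi> i" using that by (simp add: U_def r_def V_def F_def)
  qed
  ultimately show ?thesis by blast
qed

text \<open>
  For a polynomial in finitely many variables, membership in \<^const>\<open>PP\<close> is a condition on
  product functionals that no longer mentions partitions of the infinite index set.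
\<close>

lemma PP_mem_iff:
  assumes lam: "infinity_partition lam" and e: "weight_vector lam e"
    and B: "finite B" and f: "f \<in> polys_in B"
  shows "f \<in> PP lam e Z \<longleftrightarrow> (\<forall>\<pi> z k. admissible lam B \<pi> \<longrightarrow> z \<in> Z \<longrightarrow> (\<forall>i\<in>B. k i < e ! \<pi> i) \<longrightarrow>
     prodfun B (\<lambda>i. taylor (k i) (z (\<pi> i))) f = 0)"
proof (intro iffI allI impI)
  fix \<pi> z and k :: "nat \<Rightarrow> nat"
  assume fP: "f \<in> PP lam e Z" and adm: "admissible lam B \<pi>" and z: "z \<in> Z"
    and k: "\<forall>i\<in>B. k i < e ! \<pi> i"
  obtain U where U: "partition_of_type lam U" "\<forall>i\<in>B. part_index U i = \<pi> i"
    using admissible_extend[OF lam B adm] by blast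
  define x where "x i = z (part_index U i)" for i
  define iks where "iks = map (\<lambda>i. (i, k i)) (sorted_list_of_set B)"
  have x: "x \<in> point_set U Z" using z by (auto simp: point_set_def x_def)
  have fst: "map fst iks = sorted_list_of_set B" by (simp add: iks_def comp_def)
  then have d: "distinct (map fst iks)" by simp
  have set: "set iks = (\<lambda>i. (i, k i)) ` B" using B by (simp add: iks_def)
  have "eval_poly x (mixed_deriv iks f) = 0"
  proof -
    have "\<forall>(i, j)\<in>set iks. j < e ! part_index U i" using k U(2) by (auto simp: set)
    then show ?thesis using fP U(1) x d unfolding PP_def by blast
  qed
  moreover have "eval_poly x (mixed_deriv iks f) = (\<Prod>(i, k)\<leftarrow>iks. fact k) *
     prodfun B (\<lambda>i. taylor (Poly_Mapping.lookup (orders iks) i) (x i)) f"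
    by (rule eval_mixed_deriv) (use d B f in \<open>auto simp: set\<close>)
  moreover have "(\<Prod>(i, k)\<leftarrow>js. fact k) \<noteq> (0::complex)" for js :: "(nat \<times> nat) list"
    by (induction js) auto
  ultimately have "prodfun B (\<lambda>i. taylor (Poly_Mapping.lookup (orders iks) i) (x i)) f = 0"
    by simp
  then show "prodfun B (\<lambda>i. taylor (k i) (z (\<pi> i))) f = 0"
  proof (subst prodfun_cong)
    fix i j assume "i \<in> B"
    then show "taylor (k i) (z (\<pi> i)) j = taylor (Poly_Mapping.lookup (orders iks) i) (x i) j"
      using U(2) orders_in[OF d, of i "k i"] by (simp add: x_def set)
  qed
next
  assume *: "\<forall>\<pi> z k. admissible lam B \<pi> \<longrightarrow> z \<in> Z \<longrightarrow> (\<forall>i\<in>B. k i < e ! \<pi> i) \<longrightarrow>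
     prodfun B (\<lambda>i. taylor (k i) (z (\<pi> i))) f = 0"
  show "f \<in> PP lam e Z"
    unfolding PP_def mem_Collect_eq
  proof (intro allI ballI impI)
    fix U x iks
    assume U: "partition_of_type lam U" and x: "x \<in> point_set U Z"
      and d: "distinct (map fst iks)" and iks: "\<forall>(i, k)\<in>set iks. k < e ! part_index U i"
    obtain z where z: "z \<in> Z" "\<And>i. x i = z (part_index U i)"
      using x by (auto simp: point_set_def)
    define A where "A = B \<union> fst ` set iks"
    have A: "finite A" "B \<subseteq> A" using B by (auto simp: A_def)
    let ?k = "Poly_Mapping.lookup (orders iks)"
    have k: "?k i < e ! part_index U i" for i
    proof (cases "i \<in> fst ` set iks")
      case True
      then show ?thesis using iks orders_in[OF d] by auto
    next
      case False
      have "e ! part_index U i \<in> set e"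
        using e part_index_mem(1)[OF U] by (auto simp: weight_vector_def)
      then show ?thesis using e False by (auto simp: orders_notin weight_vector_def)
    qed
    have "eval_poly x (mixed_deriv iks f) = (\<Prod>(i, k)\<leftarrow>iks. fact k) *
        prodfun A (\<lambda>i. taylor (?k i) (x i)) f"
      by (rule eval_mixed_deriv) (use d A polys_in_mono[OF A(2) f] in \<open>auto simp: A_def\<close>)
    also have "prodfun A (\<lambda>i. taylor (?k i) (x i)) f = 0"
      unfolding z(2) using * admissible_part_index[OF U B] z(1) k
      by (simp add: prodfun_enlarge[OF A f])
    finally show "eval_poly x (mixed_deriv iks f) = 0" by simp
  qed
qed

section \<open>Polynomial functions and Zariski closure\<close>

text \<open>
  A complex-valued function of points that is given by a polynomial in the coordinates \<open>E\<close>.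
\<close>

definition polynomial_map :: "nat set \<Rightarrow> ((nat \<Rightarrow> complex) \<Rightarrow> complex) \<Rightarrow> bool" where
  "polynomial_map E F \<longleftrightarrow> (\<exists>g\<in>polys_in E. \<forall>x. F x = eval_poly x g)"

lemma polynomial_map_const: "polynomial_map E (\<lambda>x. c)"
  unfolding polynomial_map_def by (rule bexI[of _ "Const c"]) (auto simp: polys_in_Const)

lemma polynomial_map_coord: "i \<in> E \<Longrightarrow> polynomial_map E (\<lambda>x. x i)"
  unfolding polynomial_map_def by (rule bexI[of _ "Var i"]) (auto simp: polys_in_Var)

lemma polynomial_map_add:
  "polynomial_map E F \<Longrightarrow> polynomial_map E G \<Longrightarrow> polynomial_map E (\<lambda>x. F x + G x)"
  unfolding polynomial_map_def by (metis eval_poly_add polys_in_add)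

lemma polynomial_map_mult:
  "polynomial_map E F \<Longrightarrow> polynomial_map E G \<Longrightarrow> polynomial_map E (\<lambda>x. F x * G x)"
  unfolding polynomial_map_def by (metis eval_poly_mult polys_in_mult)

lemma polynomial_map_sum:
  "(\<And>a. a \<in> A \<Longrightarrow> polynomial_map E (F a)) \<Longrightarrow> polynomial_map E (\<lambda>x. \<Sum>a\<in>A. F a x)"
  by (induction A rule: infinite_finite_induct) (auto intro: polynomial_map_add polynomial_map_const)

lemma polynomial_map_prod:
  "(\<And>a. a \<in> A \<Longrightarrow> polynomial_map E (F a)) \<Longrightarrow> polynomial_map E (\<lambda>x. \<Prod>a\<in>A. F a x)"
  by (induction A rule: infinite_finite_induct) (auto intro: polynomial_map_mult polynomial_map_const)

lemma polynomial_map_power: "polynomial_map E F \<Longrightarrow> polynomial_map E (\<lambda>x. F x ^ n)"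
  by (induction n) (auto intro: polynomial_map_mult polynomial_map_const)

lemmas polynomial_map_intros = polynomial_map_const polynomial_map_coord polynomial_map_add
  polynomial_map_mult polynomial_map_sum polynomial_map_prod polynomial_map_power

lemma polynomial_map_reindex:
  assumes "g \<in> polys_in E" "\<psi> \<in> E \<rightarrow> A"
  shows "polynomial_map A (\<lambda>x. eval_poly (\<lambda>i. x (\<psi> i)) g)"
  unfolding eval_poly_def subst_poly_def
  using assms by (intro polynomial_map_intros) (auto simp: polys_in_def)

lemma closure_of_zariski:
  assumes "S \<subseteq> affine_space E"
  shows "zariski E closure_of S = {x \<in> affine_space E.
     \<forall>g\<in>polys_in E. (\<forall>s\<in>S. eval_poly s g = 0) \<longrightarrow> eval_poly x g = 0}" (is "_ = ?C")
proof (rule closure_of_unique)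
  let ?F = "{g\<in>polys_in E. \<forall>s\<in>S. eval_poly s g = 0}"
  show "S \<subseteq> ?C" using assms by auto
  have "?C = zero_locus E ?F" by (auto simp: zero_locus_def)
  then show "closedin (zariski E) ?C"
    unfolding closedin_zariski by (intro exI[of _ ?F]) auto
next
  fix T assume "S \<subseteq> T" "closedin (zariski E) T"
  then obtain F where F: "F \<subseteq> polys_in E" "T = zero_locus E F" "S \<subseteq> T"
    by (auto simp: closedin_zariski)
  have "eval_poly s g = 0" if "g \<in> F" "s \<in> S" for g s
    using F that by (auto simp: zero_locus_def)
  then show "?C \<subseteq> T" using F by (auto simp: zero_locus_def)
qed

section \<open>Divided differences\<close>

text \<open>
  The power series \<open>1 / (1 - w X)\<close>.
\<close>

definition geometric :: "complex \<Rightarrow> complex fps" where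
  "geometric w = Abs_fps (\<lambda>n. w ^ n)"

lemma geometric_inverse: "(1 - fps_const w * fps_X) * geometric w = 1"
proof (rule fps_ext)
  fix n
  show "fps_nth ((1 - fps_const w * fps_X) * geometric w) n = fps_nth 1 n"
    by (cases n) (simp_all add: geometric_def left_diff_distrib mult.assoc)
qed

lemma geometric_diff:
  "geometric a - geometric b = fps_const (a - b) * fps_X * geometric a * geometric b"
proof -
  let ?u = "\<lambda>w. 1 - fps_const w * fps_X :: complex fps"
  have "geometric a - geometric b =
     geometric a * (?u b * geometric b) - geometric b * (?u a * geometric a)"
    by (simp add: geometric_inverse)
  also have "\<dots> = (?u b - ?u a) * (geometric a * geometric b)"
    by (simp add: algebra_simps)
  also have "?u b - ?u a = fps_const (a - b) * fps_X"
    by (simp add: algebra_simps flip: fps_const_sub)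
  finally show ?thesis by (simp add: mult.assoc)
qed

text \<open>
  The divided difference with node multiset \<open>M\<close>, as a functional on univariate polynomials:
  on the \<open>j\<close>-th power it is the complete homogeneous symmetric polynomial of degree
  \<open>j - (size M - 1)\<close> in the nodes, read off from its generating function.  In this form it is
  visibly polynomial in the nodes, also where nodes collide.  It vanishes for
  \<open>j < size M - 1\<close>; the multiset is meant to be nonempty.
\<close>

definition divided_difference :: "complex multiset \<Rightarrow> nat \<Rightarrow> complex" where
  "divided_difference M j = fps_nth (fps_X ^ (size M - 1) * (\<Prod>w\<in>#M. geometric w)) j"

lemma divided_difference_rec:
  assumes "a \<noteq> b"
  shows "divided_difference (add_mset a (add_mset b M)) j =
     (1 / (a - b)) * divided_difference (add_mset a M) j +
     (- 1 / (a - b)) * divided_difference (add_mset b M) j"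
proof -
  let ?P = "fps_X ^ size M * (\<Prod>w\<in>#M. geometric w)"
  have "?P * geometric a - ?P * geometric b = ?P * (geometric a - geometric b)"
    by (simp add: algebra_simps)
  also have "\<dots> = fps_const (a - b) * (fps_X ^ Suc (size M) * (geometric a * (geometric b * (\<Prod>w\<in>#M. geometric w))))"
    by (simp add: geometric_diff mult_ac)
  finally have "fps_nth (?P * geometric a) j - fps_nth (?P * geometric b) j =
      (a - b) * divided_difference (add_mset a (add_mset b M)) j"
    by (simp add: divided_difference_def flip: fps_sub_nth)
  moreover have "divided_difference (add_mset w M) j = fps_nth (?P * geometric w) j" for w
    by (simp add: divided_difference_def mult_ac)
  ultimately have "(a - b) * divided_difference (add_mset a (add_mset b M)) j =
      divided_difference (add_mset a M) j - divided_difference (add_mset b M) j"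
    by metis
  then show ?thesis using assms by (simp add: divide_simps mult.commute)
qed

text \<open>
  When all nodes coincide, the divided difference is a Taylor coefficient.
\<close>

lemma divided_difference_replicate:
  "divided_difference (replicate_mset (Suc k) w) = taylor k w"
proof
  fix j
  let ?Q = "\<lambda>k. fps_X ^ k * geometric w ^ Suc k"
  have "fps_nth (?Q k) j = taylor k w j" for j
  proof (induction k arbitrary: j)
    case 0
    then show ?case by (simp add: geometric_def taylor_def)
  next
    case (Suc k)
    note IH = Suc.IH
    \<comment> \<open>Multiplying by \<open>1 - w X\<close> turns the passage from \<open>k\<close> to \<open>k + 1\<close> into Pascal's rule.\<close>
    have "?Q (Suc k) = fps_X * (geometric w * ?Q k)"
      by (simp only: power_Suc mult_ac)
    then have "(1 - fps_const w * fps_X) * ?Q (Suc k) =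
        fps_X * ((1 - fps_const w * fps_X) * geometric w * ?Q k)"
      by (simp only: mult_ac)
    then have eq: "(1 - fps_const w * fps_X) * ?Q (Suc k) = fps_X * ?Q k"
      by (simp only: geometric_inverse mult_1)
    then have Q: "?Q (Suc k) = fps_X * ?Q k + fps_const w * (fps_X * ?Q (Suc k))"
    proof -
      have *: "q = (1 - c * x) * q + c * (x * q)" for q c x :: "complex fps"
        by (simp add: algebra_simps)
      show ?thesis
        by (rule trans[OF *[of "?Q (Suc k)" "fps_const w" fps_X]]) (simp only: eq)
    qed
    define q where "q = ?Q (Suc k)"
    have rec: "fps_nth q j = fps_nth (fps_X * ?Q k) j + w * fps_nth (fps_X * q) j" for j
      using arg_cong[OF Q, of "\<lambda>f. fps_nth f j"] unfolding q_def[symmetric]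
      by (simp only: fps_add_nth fps_mult_left_const_nth)
    have "fps_nth q j = taylor (Suc k) w j"
    proof (induction j)
      case 0
      then show ?case using rec[of 0] by (simp add: taylor_def)
    next
      case (Suc j)
      have "fps_nth q (Suc j) = taylor k w j + w * taylor (Suc k) w j"
        using rec[of "Suc j"] Suc IH[of j] by (simp only: fps_X_mult_nth) simp
      also have "\<dots> = taylor (Suc k) w (Suc j)"
      proof (cases "k < j")
        case True
        then have "w * w ^ (j - Suc k) = w ^ (j - k)"
          by (metis Suc_diff_Suc power_Suc)
        then show ?thesis by (simp add: taylor_def algebra_simps)
      qed (auto simp: taylor_def algebra_simps)
      finally show ?case .
    qed
    then show ?case by (simp only: q_def)
  qed
  then show "divided_difference (replicate_mset (Suc k) w) j = taylor k w j"
    by (simp add: divided_difference_def)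
qed


lemma polynomial_map_divided_difference:
  assumes "set_mset K \<subseteq> E"
  shows "polynomial_map E (\<lambda>x. divided_difference (image_mset x K) j)"
proof -
  have "polynomial_map E (\<lambda>x. fps_nth (\<Prod>w\<in>#image_mset x K. geometric w) n)" for n
    using assms
  proof (induction K arbitrary: n)
    case empty
    show ?case by (simp add: polynomial_map_const)
  next
    case (add \<alpha> K)
    then show ?case
      by (simp add: fps_mult_nth geometric_def) (intro polynomial_map_intros; simp)
  qed
  then show ?thesis
    by (cases "j < size K - 1")
      (simp_all add: divided_difference_def fps_X_power_mult_nth polynomial_map_const)
qed

text \<open>
  Finite linear combinations of functionals in \<open>S\<close>.
\<close>

inductive lincomb :: "(nat \<Rightarrow> complex) set \<Rightarrow> (nat \<Rightarrow> complex) \<Rightarrow> bool" for S where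
  base: "l \<in> S \<Longrightarrow> lincomb S l"
| comb: "lincomb S l1 \<Longrightarrow> lincomb S l2 \<Longrightarrow> (\<And>j. l j = u * l1 j + v * l2 j) \<Longrightarrow> lincomb S l"

lemma lincomb_mono: "lincomb S l \<Longrightarrow> S \<subseteq> T \<Longrightarrow> lincomb T l"
  by (induction rule: lincomb.induct) (auto intro: lincomb.intros)

text \<open>
  As long as distinct indices have distinct nodes, a divided difference only involves the
  Taylor coefficients at each node of order less than the multiplicity of the node.
\<close>

lemma divided_difference_lincomb:
  assumes "K \<noteq> {#}" "inj_on z (set_mset K)"
  shows "lincomb {taylor k (z \<alpha>) | \<alpha> k. k < count K \<alpha>} (divided_difference (image_mset z K))"
  using assms
proof (induction "size K" arbitrary: K rule: less_induct)
  case less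
  obtain \<alpha> where \<alpha>: "\<alpha> \<in># K" using less.prems(1) by blast
  show ?case
  proof (cases "set_mset K = {\<alpha>}")
    case True
    then have K: "K = replicate_mset (size K) \<alpha>"
      by (metis set_mset_subset_singletonD subset_refl)
    moreover obtain k where k: "size K = Suc k" using less.prems(1) by (cases "size K") auto
    ultimately have "divided_difference (image_mset z K) = taylor k (z \<alpha>)"
      by (metis divided_difference_replicate image_replicate_mset)
    moreover have "k < count K \<alpha>" by (subst K) (simp add: k)
    ultimately show ?thesis by (auto intro: lincomb.base)
  next
    case False
    then obtain \<beta> where \<beta>: "\<beta> \<in># K" "\<beta> \<noteq> \<alpha>" using \<alpha> by blast
    obtain K1 where K1: "K = add_mset \<alpha> K1" using mset_add[OF \<alpha>] by blast
    then have "\<beta> \<in># K1" using \<beta> by simp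
    then obtain L where "K1 = add_mset \<beta> L" using mset_add by metis
    with K1 have K: "K = add_mset \<alpha> (add_mset \<beta> L)" by simp
    have z: "z \<alpha> \<noteq> z \<beta>" using less.prems(2) \<alpha> \<beta> by (auto simp: inj_on_def)
    have *: "lincomb {taylor k (z \<alpha>) | \<alpha> k. k < count K \<alpha>} (divided_difference (image_mset z (add_mset \<gamma> L)))"
      if "\<gamma> = \<alpha> \<or> \<gamma> = \<beta>" for \<gamma>
    proof (rule lincomb_mono)
      show "lincomb {taylor k (z \<alpha>') | \<alpha>' k. k < count (add_mset \<gamma> L) \<alpha>'}
         (divided_difference (image_mset z (add_mset \<gamma> L)))"
        by (rule less.hyps) (use less.prems(2) that in \<open>auto simp: K inj_on_def\<close>)
      have "count (add_mset \<gamma> L) x \<le> count K x" for x using that by (auto simp: K)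
      then show "{taylor k (z \<alpha>) | \<alpha> k. k < count (add_mset \<gamma> L) \<alpha>} \<subseteq> {taylor k (z \<alpha>) | \<alpha> k. k < count K \<alpha>}"
        using order_less_le_trans by blast
    qed
    \<comment> \<open>Two different nodes are present, so the recursion for divided differences applies.\<close>
    show ?thesis
    proof (rule lincomb.comb[OF *[of \<alpha>] *[of \<beta>]])
      show "divided_difference (image_mset z K) j =
          1 / (z \<alpha> - z \<beta>) * divided_difference (image_mset z (add_mset \<alpha> L)) j +
          - 1 / (z \<alpha> - z \<beta>) * divided_difference (image_mset z (add_mset \<beta> L)) j" for j
        unfolding K image_mset_add_mset by (rule divided_difference_rec[OF z])
    qed simp_all
  qed
qed

lemma prodfun_lincomb_eq_0:
  assumes B: "finite B" and l: "\<And>i. i \<in> B \<Longrightarrow> lincomb (S i) (l i)"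
    and S: "\<And>l. (\<And>i. i \<in> B \<Longrightarrow> l i \<in> S i) \<Longrightarrow> prodfun B l f = 0"
  shows "prodfun B l f = 0"
proof -
  have "\<forall>l. (\<forall>i\<in>A. lincomb (S i) (l i)) \<longrightarrow> (\<forall>i\<in>B - A. l i \<in> S i) \<longrightarrow> prodfun B l f = 0"
    if "finite A" "A \<subseteq> B" for A
    using that
  proof (induction A rule: finite_induct)
    case empty
    then show ?case using S by simp
  next
    case (insert a A)
    show ?case
    proof (intro allI impI)
      fix l assume l: "\<forall>i\<in>insert a A. lincomb (S i) (l i)" "\<forall>i\<in>B - insert a A. l i \<in> S i"
      have "prodfun B (l(a := h)) f = 0" if "lincomb (S a) h" for h
        using that
      proof (induction rule: lincomb.induct)
        case (base h)
        have "\<forall>i\<in>A. lincomb (S i) ((l(a := h)) i)" "\<forall>i\<in>B - A. (l(a := h)) i \<in> S i"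
          using l base insert.hyps by auto
        then show ?case using insert.IH insert.prems by blast
      next
        case (comb h1 h2 h u v)
        have "prodfun B (l(a := h)) f =
            u * prodfun B (l(a := h1)) f + v * prodfun B (l(a := h2)) f"
          using prodfun_comb[OF B, of a "l(a := h)" u h1 v h2 f] insert.prems comb.hyps by simp
        then show ?case by (simp only: comb.IH) simp
      qed
      from this[of "l a"] l show "prodfun B l f = 0" by simp
    qed
  qed
  from this[of B] B l show ?thesis by simp
qed

section \<open>Distributing points among the parts\<close>

lemma ex_bounded_multiset:
  assumes "finite A" "n \<le> (\<Sum>\<alpha>\<in>A. e \<alpha>)"
  shows "\<exists>K. set_mset K \<subseteq> A \<and> size K = n \<and> (\<forall>\<alpha>. count K \<alpha> \<le> e \<alpha>)"
  using assms(2)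
proof (induction n)
  case 0
  then show ?case by (intro exI[of _ "{#}"]) auto
next
  case (Suc n)
  then obtain K where K: "set_mset K \<subseteq> A" "size K = n" "\<forall>\<alpha>. count K \<alpha> \<le> e \<alpha>" by auto
  have "size K = (\<Sum>\<alpha>\<in>A. count K \<alpha>)"
    unfolding size_multiset_overloaded_eq
    by (rule sum.mono_neutral_left) (use K(1) assms(1) in \<open>auto simp: not_in_iff\<close>)
  with K(2) Suc.prems have "(\<Sum>\<alpha>\<in>A. count K \<alpha>) < (\<Sum>\<alpha>\<in>A. e \<alpha>)" by simp
  then obtain \<alpha> where \<alpha>: "\<alpha> \<in> A" "count K \<alpha> < e \<alpha>"
    by (meson not_le sum_mono)
  then show ?case using K by (intro exI[of _ "add_mset \<alpha> K"]) (auto simp: Suc_le_eq)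
qed

lemma ex_bounded_assignment:
  fixes c :: "'b \<Rightarrow> enat"
  assumes "finite T" "finite A" "enat (card A) \<le> (\<Sum>t\<in>T. c t)"
  shows "\<exists>g\<in>A \<rightarrow> T. \<forall>t\<in>T. enat (card {a\<in>A. g a = t}) \<le> c t"
  using assms
proof (induction T arbitrary: A rule: finite_induct)
  case empty
  then show ?case by (auto simp: zero_enat_def)
next
  case (insert t T)
  show ?case
  proof (cases "enat (card A) \<le> c t")
    case True
    then have "enat (card {a\<in>A. t = s}) \<le> c s" if "s \<in> insert t T" for s
      by (cases "t = s") (auto simp flip: zero_enat_def)
    then show ?thesis by (intro bexI[of _ "\<lambda>_. t"]) auto
  next
    case False
    then obtain n where n: "c t = enat n" "n < card A" by (cases "c t") auto
    then obtain A1 where A1: "A1 \<subseteq> A" "card A1 = n"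
      by (meson less_imp_le obtain_subset_with_card_n)
    have "enat (card (A - A1)) \<le> (\<Sum>t\<in>T. c t)"
    proof (cases "\<Sum>t\<in>T. c t")
      case (enat N)
      then show ?thesis
        using insert n A1 by (simp add: card_Diff_subset finite_subset)
    qed simp
    then obtain g where g: "g \<in> A - A1 \<rightarrow> T" "\<forall>t\<in>T. enat (card {a\<in>A - A1. g a = t}) \<le> c t"
      using insert.IH[of "A - A1"] insert.prems by auto
    define h where "h a = (if a \<in> A1 then t else g a)" for a
    have "{a\<in>A. h a = t} = A1"
      using g(1) insert.hyps A1(1) by (auto simp: h_def Pi_iff)
    moreover have "{a\<in>A. h a = s} = {a\<in>A - A1. g a = s}" if "s \<in> T" for s
      using that insert.hyps by (auto simp: h_def)
    ultimately have "\<forall>s\<in>insert t T. enat (card {a\<in>A. h a = s}) \<le> c s"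
      using g(2) n A1 by auto
    moreover have "h \<in> A \<rightarrow> insert t T" using g(1) by (auto simp: h_def Pi_iff)
    ultimately show ?thesis by blast
  qed
qed

section \<open>Maps between partitions and containment of ideals\<close>

text \<open>
  The conditions on the subset \<open>E\<close> and the map \<open>\<phi>\<close> that concern the partitions and the
  weights only, but not the varieties.
\<close>

definition compatible ::
    "enat list \<Rightarrow> nat list \<Rightarrow> enat list \<Rightarrow> nat list \<Rightarrow> nat set \<Rightarrow> (nat \<Rightarrow> nat) \<Rightarrow> bool" where
  "compatible lam e mu d E \<phi> \<longleftrightarrow> E \<subseteq> {..<length lam} \<and> \<phi> \<in> E \<rightarrow> {..<length mu} \<and>
     (\<forall>\<beta><length mu. mu ! \<beta> \<le> (\<Sum>\<alpha>\<in>{\<alpha>\<in>E. \<phi> \<alpha> = \<beta>}. lam ! \<alpha>)) \<and>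
     (\<forall>\<beta><length mu. mu ! \<beta> = \<infinity> \<longrightarrow>
        d ! \<beta> \<le> (\<Sum>\<alpha>\<in>{\<alpha>\<in>E. \<phi> \<alpha> = \<beta> \<and> lam ! \<alpha> = \<infinity>}. e ! \<alpha>))"

lemma reduced_weight_pos:
  "reduced_weight lam e \<Longrightarrow> \<alpha> < length lam \<Longrightarrow> 0 < e ! \<alpha>"
  by (auto simp: reduced_weight_def weight_vector_def)

text \<open>
  Compatible maps give containments.  To test a Taylor coefficient of order \<open>k i\<close> in each variable \<open>i\<close> at a
  point given by \<open>y\<close>, each \<open>i\<close> gets a multiset of \<open>k i + 1\<close> indices of parts that \<open>\<phi>\<close> maps to
  the part of \<open>i\<close>.  The product of the divided differences with these nodes vanishes at the
  points of \<open>Z\<close>; being polynomial in the nodes, it vanishes on the closure of the projection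
  of \<open>Z\<close>, in particular at the image of \<open>y\<close>, where it is the desired Taylor coefficient.
\<close>

lemma PP_subset_PP:
  assumes lam: "infinity_partition lam" and mu: "infinity_partition mu"
    and e: "reduced_weight lam e" and d: "reduced_weight mu d"
    and Z: "Z \<subseteq> distinct_locus (length lam)"
    and compat: "compatible lam e mu d E \<phi>"
    and Y: "\<And>y. y \<in> Y \<Longrightarrow> multidiagonal E \<phi> y \<in> zariski E closure_of (coord_proj E ` Z)"
  shows "PP lam e Z \<subseteq> PP mu d Y"
proof
  fix f assume f: "f \<in> PP lam e Z"
  obtain B where B: "finite B" "f \<in> polys_in B" using polys_in_finite by blast
  have we: "weight_vector lam e" and wd: "weight_vector mu d"
    using e d by (auto simp: reduced_weight_def)
  have E: "E \<subseteq> {..<length lam}" and \<phi>: "\<phi> \<in> E \<rightarrow> {..<length mu}"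
    and size: "\<And>\<beta>. \<beta> < length mu \<Longrightarrow> mu ! \<beta> \<le> (\<Sum>\<alpha>\<in>{\<alpha>\<in>E. \<phi> \<alpha> = \<beta>}. lam ! \<alpha>)"
    and weight: "\<And>\<beta>. \<beta> < length mu \<Longrightarrow> mu ! \<beta> = \<infinity> \<Longrightarrow>
      d ! \<beta> \<le> (\<Sum>\<alpha>\<in>{\<alpha>\<in>E. \<phi> \<alpha> = \<beta> \<and> lam ! \<alpha> = \<infinity>}. e ! \<alpha>)"
    using compat by (auto simp: compatible_def)
  have finE: "finite E" using E finite_subset by blast
  show "f \<in> PP mu d Y"
    unfolding PP_mem_iff[OF mu wd B]
  proof (intro allI impI)
    fix \<rho> y and k :: "nat \<Rightarrow> nat"
    assume \<rho>: "admissible mu B \<rho>" and y: "y \<in> Y" and k: "\<forall>i\<in>B. k i < d ! \<rho> i"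
    have \<rho>_less: "\<rho> i < length mu" if "i \<in> B" for i
      using \<rho> that by (auto simp: admissible_def)
    \<comment> \<open>The indices in each part are distributed over the fibre of \<open>\<phi>\<close>; only the result for
      finite parts, where the sizes in the fibre constrain, is used.\<close>
    let ?G = "\<lambda>\<beta> g. \<beta> < length mu \<longrightarrow> g \<in> {i\<in>B. \<rho> i = \<beta>} \<rightarrow> {\<alpha>\<in>E. \<phi> \<alpha> = \<beta>} \<and>
        (\<forall>\<alpha>\<in>{\<alpha>\<in>E. \<phi> \<alpha> = \<beta>}. enat (card {i\<in>{i\<in>B. \<rho> i = \<beta>}. g i = \<alpha>}) \<le> lam ! \<alpha>)"
    have "\<exists>g. ?G \<beta> g" for \<beta>
    proof (cases "\<beta> < length mu")
      case True
      then have "enat (card {i\<in>B. \<rho> i = \<beta>}) \<le> mu ! \<beta>"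
        using \<rho> by (simp add: admissible_def)
      also note size[OF True]
      finally show ?thesis
        using ex_bounded_assignment[of "{\<alpha>\<in>E. \<phi> \<alpha> = \<beta>}" "{i\<in>B. \<rho> i = \<beta>}" "(!) lam"] finE B(1)
        by auto
    qed simp
    then have "\<forall>\<beta>. \<exists>g. ?G \<beta> g" by blast
    from choice[OF this] obtain g where g: "\<And>\<beta>. \<beta> < length mu \<Longrightarrow> g \<beta> \<in> {i\<in>B. \<rho> i = \<beta>} \<rightarrow> {\<alpha>\<in>E. \<phi> \<alpha> = \<beta>}"
      "\<And>\<beta> \<alpha>. \<beta> < length mu \<Longrightarrow> \<alpha> \<in> E \<Longrightarrow> \<phi> \<alpha> = \<beta> \<Longrightarrow>
         enat (card {i\<in>{i\<in>B. \<rho> i = \<beta>}. g \<beta> i = \<alpha>}) \<le> lam ! \<alpha>"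
      by blast
    define good where "good i K \<longleftrightarrow> size K = Suc (k i) \<and> set_mset K \<subseteq> {\<alpha>\<in>E. \<phi> \<alpha> = \<rho> i} \<and>
      (\<forall>\<alpha>. count K \<alpha> \<le> e ! \<alpha>) \<and>
      (if mu ! \<rho> i = \<infinity> then \<forall>\<alpha>\<in>#K. lam ! \<alpha> = \<infinity> else K = {#g (\<rho> i) i#})" for i K
    have "\<exists>K. good i K" if i: "i \<in> B" for i
    proof (cases "mu ! \<rho> i = \<infinity>")
      case True
      let ?A = "{\<alpha>\<in>E. \<phi> \<alpha> = \<rho> i \<and> lam ! \<alpha> = \<infinity>}"
      have "Suc (k i) \<le> (\<Sum>\<alpha>\<in>?A. e ! \<alpha>)"
        using k i weight[OF \<rho>_less[OF i] True] by fastforce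
      then obtain K where "set_mset K \<subseteq> ?A" "size K = Suc (k i)" "\<forall>\<alpha>. count K \<alpha> \<le> e ! \<alpha>"
        using ex_bounded_multiset[of ?A "Suc (k i)" "(!) e"] finE by auto
      then show ?thesis using True by (auto simp: good_def)
    next
      case False
      have "d ! \<rho> i = 1" using d False \<rho>_less[OF i] by (auto simp: reduced_weight_def)
      then have "k i = 0" using k i by auto
      moreover have g: "g (\<rho> i) i \<in> {\<alpha>\<in>E. \<phi> \<alpha> = \<rho> i}"
        using g(1)[OF \<rho>_less[OF i]] i by auto
      moreover have "0 < e ! g (\<rho> i) i"
        using reduced_weight_pos[OF e] g E by auto
      ultimately have "good i {#g (\<rho> i) i#}" using False by (auto simp: good_def Suc_le_eq)
      then show ?thesis by blast
    qed
    then obtain K where K: "\<And>i. i \<in> B \<Longrightarrow> good i (K i)" by metis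
    have KE: "set_mset (K i) \<subseteq> E" if "i \<in> B" for i using K[OF that] by (auto simp: good_def)
    define F where "F x = prodfun B (\<lambda>i. divided_difference (image_mset x (K i))) f" for x
    \<comment> \<open>Expanding every divided difference leaves Taylor coefficients at assignments of parts to
      the variables that are admissible for \<open>lam\<close>, and these kill \<open>f\<close>.\<close>
    have FZ: "F z = 0" if z: "z \<in> Z" for z
      unfolding F_def
    proof (rule prodfun_lincomb_eq_0[OF B(1)])
      fix i assume i: "i \<in> B"
      have "inj_on z {..<length lam}" using Z z by (auto simp: distinct_locus_def)
      then have "inj_on z (set_mset (K i))" using KE[OF i] E inj_on_subset by blast
      moreover have "K i \<noteq> {#}" using K[OF i] by (auto simp: good_def)
      ultimately show "lincomb {taylor j (z \<alpha>) | \<alpha> j. j < count (K i) \<alpha>} (divided_difference (image_mset z (K i)))"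
        by (intro divided_difference_lincomb)
    next
      fix l assume "\<And>i. i \<in> B \<Longrightarrow> l i \<in> {taylor j (z \<alpha>) | \<alpha> j. j < count (K i) \<alpha>}"
      then have "\<forall>i\<in>B. \<exists>\<alpha> j. l i = taylor j (z \<alpha>) \<and> j < count (K i) \<alpha>" by blast
      then obtain \<pi> j where l: "\<And>i. i \<in> B \<Longrightarrow> l i = taylor (j i) (z (\<pi> i)) \<and> j i < count (K i) (\<pi> i)"
        by metis
      have \<pi>K: "\<pi> i \<in># K i" if "i \<in> B" for i
        using l[OF that] by (metis count_greater_zero_iff not_less_zero neq0_conv)
      have "admissible lam B \<pi>"
        unfolding admissible_def
      proof (intro conjI allI impI)
        show "\<pi> \<in> B \<rightarrow> {..<length lam}" using \<pi>K KE E by blast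
        fix \<alpha> assume \<alpha>: "\<alpha> < length lam"
        show "enat (card {i\<in>B. \<pi> i = \<alpha>}) \<le> lam ! \<alpha>"
        proof (cases "lam ! \<alpha> = \<infinity> \<or> {i\<in>B. \<pi> i = \<alpha>} = {}")
          case True
          then show ?thesis
          proof
            assume "{i\<in>B. \<pi> i = \<alpha>} = {}"
            then show ?thesis by (simp only: card.empty flip: zero_enat_def) simp
          qed simp
        next
          case False
          \<comment> \<open>A finite part is only used through the assignment \<open>g\<close>, which respects its size.\<close>
          then have \<alpha>E: "\<alpha> \<in> E" using \<pi>K KE by auto
          then have \<phi>\<alpha>: "\<phi> \<alpha> < length mu" using \<phi> by auto
          have "{i\<in>B. \<pi> i = \<alpha>} \<subseteq> {i\<in>{i\<in>B. \<rho> i = \<phi> \<alpha>}. g (\<phi> \<alpha>) i = \<alpha>}"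
          proof
            fix i assume "i \<in> {i\<in>B. \<pi> i = \<alpha>}"
            then have i: "i \<in> B" "\<alpha> \<in># K i" using \<pi>K by auto
            then have "\<rho> i = \<phi> \<alpha>" using K[OF i(1)] by (auto simp: good_def)
            then show "i \<in> {i\<in>{i\<in>B. \<rho> i = \<phi> \<alpha>}. g (\<phi> \<alpha>) i = \<alpha>}"
              using K[OF i(1)] i False by (auto simp: good_def split: if_splits)
          qed
          then have "enat (card {i\<in>B. \<pi> i = \<alpha>}) \<le> enat (card {i\<in>{i\<in>B. \<rho> i = \<phi> \<alpha>}. g (\<phi> \<alpha>) i = \<alpha>})"
            using B(1) by (simp add: card_mono)
          also have "\<dots> \<le> lam ! \<alpha>" using g(2)[OF \<phi>\<alpha> \<alpha>E] by simp
          finally show ?thesis .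
        qed
      qed
      moreover have "\<forall>i\<in>B. j i < e ! \<pi> i"
        using l K by (fastforce simp: good_def intro: less_le_trans)
      ultimately have "prodfun B (\<lambda>i. taylor (j i) (z (\<pi> i))) f = 0"
        using f z unfolding PP_mem_iff[OF lam we B] by blast
      then show "prodfun B l f = 0" using l by (subst prodfun_cong) auto
    qed
    have "polynomial_map E F"
      unfolding F_def prodfun_def using KE
      by (intro polynomial_map_intros polynomial_map_divided_difference)
    then obtain h where h: "h \<in> polys_in E" "\<And>x. F x = eval_poly x h"
      by (auto simp: polynomial_map_def)
    have "eval_poly (coord_proj E z) h = 0" if "z \<in> Z" for z
      using FZ[OF that] h(2) eval_poly_cong[OF h(1), of "coord_proj E z" z]
      by (simp add: coord_proj_def)
    moreover have "coord_proj E ` Z \<subseteq> affine_space E"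
      by (auto simp: coord_proj_def affine_space_def)
    ultimately have "F (multidiagonal E \<phi> y) = 0"
      using Y[OF y] h by (auto simp: closure_of_zariski)
    moreover have "divided_difference (image_mset (multidiagonal E \<phi> y) (K i)) = taylor (k i) (y (\<rho> i))"
      if i: "i \<in> B" for i
    proof -
      have "image_mset (multidiagonal E \<phi> y) (K i) = image_mset (\<lambda>_. y (\<rho> i)) (K i)"
        using K[OF i] by (intro image_mset_cong) (auto simp: good_def multidiagonal_def)
      also have "\<dots> = replicate_mset (Suc (k i)) (y (\<rho> i))"
        using K[OF i] by (simp add: good_def image_mset_const_eq)
      finally show ?thesis by (simp only: divided_difference_replicate)
    qed
    ultimately show "prodfun B (\<lambda>i. taylor (k i) (y (\<rho> i))) f = 0"
      unfolding F_def by (subst prodfun_cong) auto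
  qed
qed

section \<open>Taylor coefficients of products\<close>

lemma prodfun_1 [simp]: "prodfun B l 1 = (\<Prod>i\<in>B. l i 0)"
  by (simp add: prodfun_def lookup_one)

lemma prodfun_mult_disjoint:
  assumes fin: "finite A" "finite B" and disj: "A \<inter> B = {}"
    and f: "f \<in> polys_in A" and g: "g \<in> polys_in B"
  shows "prodfun (A \<union> B) l (f * g) = prodfun A l f * prodfun B l g"
proof -
  have "(\<Prod>i\<in>A \<union> B. l i (Poly_Mapping.lookup m i + Poly_Mapping.lookup n i)) =
     (\<Prod>i\<in>A. l i (Poly_Mapping.lookup m i)) * (\<Prod>i\<in>B. l i (Poly_Mapping.lookup n i))"
    if "m \<in> Poly_Mapping.keys f" "n \<in> Poly_Mapping.keys g" for m n
  proof -
    have "(\<Prod>i\<in>A. l i (Poly_Mapping.lookup m i + Poly_Mapping.lookup n i)) =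
        (\<Prod>i\<in>A. l i (Poly_Mapping.lookup m i))"
      by (intro prod.cong refl) (metis IntI add.right_neutral disj empty_iff g polys_inD that(2))
    moreover have "(\<Prod>i\<in>B. l i (Poly_Mapping.lookup m i + Poly_Mapping.lookup n i)) =
        (\<Prod>i\<in>B. l i (Poly_Mapping.lookup n i))"
      by (intro prod.cong refl) (metis IntI add.left_neutral disj empty_iff f polys_inD that(1))
    ultimately show ?thesis using fin disj by (simp add: prod.union_disjoint)
  qed
  then have "prodfun (A \<union> B) l (f * g) = (\<Sum>m\<in>Poly_Mapping.keys f. \<Sum>n\<in>Poly_Mapping.keys g.
     (Poly_Mapping.lookup f m * (\<Prod>i\<in>A. l i (Poly_Mapping.lookup m i))) *
     (Poly_Mapping.lookup g n * (\<Prod>i\<in>B. l i (Poly_Mapping.lookup n i))))"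
    unfolding prodfun_mult by (intro sum.cong refl) (simp add: mult_ac)
  then show ?thesis by (simp add: prodfun_def sum_product)
qed

lemma prodfun_prod_disjoint:
  assumes "finite P" "\<And>p. p \<in> P \<Longrightarrow> finite (S p)" "\<And>p. p \<in> P \<Longrightarrow> f p \<in> polys_in (S p)"
    and "\<And>p q. p \<in> P \<Longrightarrow> q \<in> P \<Longrightarrow> p \<noteq> q \<Longrightarrow> S p \<inter> S q = {}"
  shows "prodfun (\<Union>p\<in>P. S p) l (\<Prod>p\<in>P. f p) = (\<Prod>p\<in>P. prodfun (S p) l (f p))"
  using assms
proof (induction P rule: finite_induct)
  case (insert p P)
  have "prodfun (S p \<union> (\<Union>p\<in>P. S p)) l (f p * (\<Prod>p\<in>P. f p)) =
      prodfun (S p) l (f p) * prodfun (\<Union>p\<in>P. S p) l (\<Prod>p\<in>P. f p)"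
  proof (rule prodfun_mult_disjoint)
    show "(\<Prod>p\<in>P. f p) \<in> polys_in (\<Union>p\<in>P. S p)"
      using insert.prems by (intro polys_in_prod) (meson UN_upper insertI2 polys_in_mono)
    have "S p \<inter> S q = {}" if "q \<in> P" for q
      using insert.prems(3)[of p q] insert.hyps that by auto
    then show "S p \<inter> (\<Union>p\<in>P. S p) = {}" by blast
  qed (use insert in auto)
  also have "prodfun (\<Union>p\<in>P. S p) l (\<Prod>p\<in>P. f p) = (\<Prod>p\<in>P. prodfun (S p) l (f p))"
    using insert.prems by (intro insert.IH) auto
  finally show ?case using insert.hyps by simp
qed simp

lemma taylor_add: "taylor k x (a + b) = (\<Sum>j\<le>k. taylor j x a * taylor (k - j) x b)"
proof -
  have "taylor j x a * taylor (k - j) x b =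
      of_nat ((a choose j) * (b choose (k - j))) * x ^ (a + b - k)" if "j \<le> k" for j
  proof (cases "j \<le> a \<and> k - j \<le> b")
    case True
    then have "a - j + (b - (k - j)) = a + b - k" using that by arith
    then show ?thesis by (simp add: taylor_def flip: power_add)
  next
    case False
    then have "(a choose j) * (b choose (k - j)) = 0" by (auto simp: binomial_eq_0)
    then show ?thesis by (auto simp: taylor_def)
  qed
  then have "(\<Sum>j\<le>k. taylor j x a * taylor (k - j) x b) =
      of_nat (\<Sum>j\<le>k. (a choose j) * (b choose (k - j))) * x ^ (a + b - k)"
    by (simp add: sum_distrib_right)
  then show ?thesis by (simp add: vandermonde taylor_def)
qed

abbreviation taylor_coeff :: "nat set \<Rightarrow> (nat \<Rightarrow> complex) \<Rightarrow> (nat \<Rightarrow> nat) \<Rightarrow> cpoly \<Rightarrow> complex" where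
  "taylor_coeff B x k f \<equiv> prodfun B (\<lambda>i. taylor (k i) (x i)) f"

lemma taylor_coeff_mult:
  assumes "finite B"
  shows "taylor_coeff B x k (f * g) =
     (\<Sum>\<kappa>\<in>(\<Pi>\<^sub>E i\<in>B. {..k i}). taylor_coeff B x \<kappa> f * taylor_coeff B x (\<lambda>i. k i - \<kappa> i) g)"
proof -
  let ?P = "\<Pi>\<^sub>E i\<in>B. {..k i}"
  have "(\<Prod>i\<in>B. taylor (k i) (x i) (a i + b i)) =
     (\<Sum>\<kappa>\<in>?P. (\<Prod>i\<in>B. taylor (\<kappa> i) (x i) (a i)) * (\<Prod>i\<in>B. taylor (k i - \<kappa> i) (x i) (b i)))" for a b
    using assms by (simp add: taylor_add prod_sum_PiE prod.distrib)
  then have "taylor_coeff B x k (f * g) = (\<Sum>m\<in>Poly_Mapping.keys f. \<Sum>n\<in>Poly_Mapping.keys g. \<Sum>\<kappa>\<in>?P.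
     (Poly_Mapping.lookup f m * (\<Prod>i\<in>B. taylor (\<kappa> i) (x i) (Poly_Mapping.lookup m i))) *
     (Poly_Mapping.lookup g n * (\<Prod>i\<in>B. taylor (k i - \<kappa> i) (x i) (Poly_Mapping.lookup n i))))"
    unfolding prodfun_mult by (simp add: sum_distrib_left mult_ac)
  also have "\<dots> = (\<Sum>\<kappa>\<in>?P. \<Sum>m\<in>Poly_Mapping.keys f. \<Sum>n\<in>Poly_Mapping.keys g.
     (Poly_Mapping.lookup f m * (\<Prod>i\<in>B. taylor (\<kappa> i) (x i) (Poly_Mapping.lookup m i))) *
     (Poly_Mapping.lookup g n * (\<Prod>i\<in>B. taylor (k i - \<kappa> i) (x i) (Poly_Mapping.lookup n i))))"
    by (subst (2) sum.swap, subst sum.swap) (rule refl)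
  finally show ?thesis by (simp add: prodfun_def sum_product)
qed

text \<open>
  The polynomials whose Taylor coefficients of orders below \<open>w\<close> all vanish form an ideal.
\<close>

lemma taylor_coeff_mult_eq_0:
  assumes "finite B" "\<And>\<kappa>. \<forall>i\<in>B. \<kappa> i < w i \<Longrightarrow> taylor_coeff B x \<kappa> f = 0" "\<forall>i\<in>B. k i < w i"
  shows "taylor_coeff B x k (f * g) = 0"
  unfolding taylor_coeff_mult[OF assms(1)]
proof (intro sum.neutral ballI)
  fix \<kappa> assume "\<kappa> \<in> (\<Pi>\<^sub>E i\<in>B. {..k i})"
  then have "\<forall>i\<in>B. \<kappa> i < w i" using assms(3) by (fastforce simp: PiE_iff)
  then show "taylor_coeff B x \<kappa> f * taylor_coeff B x (\<lambda>i. k i - \<kappa> i) g = 0"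
    using assms(2) by simp
qed

lemma taylor_coeff_power_eq_0:
  assumes B: "finite B" and h: "h \<in> polys_in B" "eval_poly x h = 0"
  shows "(\<Sum>i\<in>B. k i) < N \<Longrightarrow> taylor_coeff B x k (h ^ N) = 0"
proof (induction N arbitrary: k)
  case (Suc N)
  have "taylor_coeff B x \<kappa> h * taylor_coeff B x (\<lambda>i. k i - \<kappa> i) (h ^ N) = 0"
    if \<kappa>: "\<kappa> \<in> (\<Pi>\<^sub>E i\<in>B. {..k i})" for \<kappa>
  proof (cases "\<forall>i\<in>B. \<kappa> i = 0")
    case True
    then have "taylor_coeff B x \<kappa> h = eval_poly x h"
      unfolding eval_poly_prodfun[OF B h(1)] by (intro prodfun_cong) simp
    then show ?thesis using h(2) by simp
  next
    case False
    then have "(\<Sum>i\<in>B. k i - \<kappa> i) < (\<Sum>i\<in>B. k i)"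
      using \<kappa> B by (intro sum_strict_mono_ex1) (fastforce simp: PiE_iff)+
    then show ?thesis using Suc by simp
  qed
  then show ?case unfolding power_Suc taylor_coeff_mult[OF B] by (intro sum.neutral) blast
qed simp

text \<open>
  Multiplying by a polynomial that does not vanish at the point cannot make all Taylor
  coefficients of orders below \<open>w\<close> vanish: one of minimal total order among the nonzero ones
  is just multiplied by the value.
\<close>

lemma taylor_coeff_mult_nonzero:
  assumes B: "finite B" and g: "g \<in> polys_in B" "eval_poly x g \<noteq> 0"
    and k: "\<forall>i\<in>B. k i < w i" "taylor_coeff B x k f \<noteq> 0"
  shows "\<exists>\<kappa>. (\<forall>i\<in>B. \<kappa> i < w i) \<and> taylor_coeff B x \<kappa> (f * g) \<noteq> 0"
proof -
  let ?Q = "\<lambda>k. (\<forall>i\<in>B. k i < w i) \<and> taylor_coeff B x k f \<noteq> 0"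
  obtain k where k: "?Q k" and min: "\<And>\<kappa>. ?Q \<kappa> \<Longrightarrow> (\<Sum>i\<in>B. k i) \<le> (\<Sum>i\<in>B. \<kappa> i)"
    using ex_has_least_nat[of ?Q k "\<lambda>k. \<Sum>i\<in>B. k i"] assms(4,5) by blast
  have r: "restrict k B \<in> (\<Pi>\<^sub>E i\<in>B. {..k i})" by auto
  have "taylor_coeff B x \<kappa> f * taylor_coeff B x (\<lambda>i. k i - \<kappa> i) g = 0"
    if \<kappa>: "\<kappa> \<in> (\<Pi>\<^sub>E i\<in>B. {..k i}) - {restrict k B}" for \<kappa>
  proof -
    have "\<exists>i\<in>B. \<kappa> i \<noteq> k i"
    proof (rule ccontr)
      assume "\<not> ?thesis"
      then have "\<kappa> = restrict k B" using \<kappa> by (auto simp: PiE_iff extensional_def)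
      then show False using \<kappa> by simp
    qed
    then have "(\<Sum>i\<in>B. \<kappa> i) < (\<Sum>i\<in>B. k i)"
      using \<kappa> B by (intro sum_strict_mono_ex1) (fastforce simp: PiE_iff)+
    then have "\<not> ?Q \<kappa>" using min by fastforce
    moreover have "\<forall>i\<in>B. \<kappa> i < w i" using \<kappa> k by (fastforce simp: PiE_iff)
    ultimately show ?thesis by simp
  qed
  then have "(\<Sum>\<kappa>\<in>(\<Pi>\<^sub>E i\<in>B. {..k i}) - {restrict k B}.
      taylor_coeff B x \<kappa> f * taylor_coeff B x (\<lambda>i. k i - \<kappa> i) g) = 0"
    by (intro sum.neutral) blast
  then have "taylor_coeff B x k (f * g) =
      taylor_coeff B x (restrict k B) f * taylor_coeff B x (\<lambda>i. k i - restrict k B i) g"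
    unfolding taylor_coeff_mult[OF B]
    by (subst sum.remove[OF _ r]) (use B in \<open>simp_all add: finite_PiE\<close>)
  also have "taylor_coeff B x (restrict k B) f = taylor_coeff B x k f"
    by (intro prodfun_cong) simp
  also have "taylor_coeff B x (\<lambda>i. k i - restrict k B i) g = eval_poly x g"
    unfolding eval_poly_prodfun[OF B g(1)] by (intro prodfun_cong) simp
  finally show ?thesis using k g(2) by auto
qed

section \<open>Alternants\<close>

text \<open>
  The Vandermonde determinant in the \<open>d\<close> variables \<open>v 0, \<dots>, v (d - 1)\<close>, expanded as an
  alternating sum over permutations.
\<close>

definition alternant :: "nat \<Rightarrow> (nat \<Rightarrow> nat) \<Rightarrow> cpoly" where
  "alternant d v = (\<Sum>\<sigma> | \<sigma> permutes {..<d}.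
     Poly_Mapping.single (\<Sum>a<d. Poly_Mapping.single (v a) (\<sigma> a)) (of_int (sign \<sigma>)))"

lemma alternant_in_polys_in: "alternant d v \<in> polys_in (v ` {..<d})"
  unfolding alternant_def
proof (rule polys_in_sum)
  fix \<sigma> :: "nat \<Rightarrow> nat"
  have "Poly_Mapping.keys (\<Sum>a<d. Poly_Mapping.single (v a) (\<sigma> a)) \<subseteq> v ` {..<d}"
    by (auto simp: in_keys_iff lookup_sum lookup_single when_def split: if_splits
      dest!: sum.not_neutral_contains_not_neutral)
  then show "Poly_Mapping.single (\<Sum>a<d. Poly_Mapping.single (v a) (\<sigma> a)) (of_int (sign \<sigma>))
      \<in> polys_in (v ` {..<d})"
    by (simp add: polys_in_def)
qed

lemma prodfun_alternant:
  assumes v: "inj_on v {..<d}"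
  shows "prodfun (v ` {..<d}) l (alternant d v) =
     (\<Sum>\<sigma> | \<sigma> permutes {..<d}. of_int (sign \<sigma>) * (\<Prod>a<d. l (v a) (\<sigma> a)))"
proof -
  have "Poly_Mapping.lookup (\<Sum>a<d. Poly_Mapping.single (v a) (\<sigma> a)) (v b) = \<sigma> b"
    if b: "b < d" for b and \<sigma> :: "nat \<Rightarrow> nat"
  proof -
    have "Poly_Mapping.lookup (\<Sum>a<d. Poly_Mapping.single (v a) (\<sigma> a)) (v b) =
        (\<Sum>a<d. if a = b then \<sigma> a else 0)"
      unfolding lookup_sum lookup_single when_def
      using v b by (intro sum.cong) (auto simp: inj_on_def)
    then show ?thesis using b by simp
  qed
  then show ?thesis
    unfolding alternant_def prodfun_sum prodfun_single
    by (simp add: prod.reindex[OF v])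
qed

text \<open>
  A generalized Vandermonde determinant with two equal rows vanishes, whatever the
  functionals are.
\<close>

lemma prodfun_alternant_eq_0:
  assumes v: "inj_on v {..<d}" and ab: "a < d" "b < d" "a \<noteq> b" "l (v a) = l (v b)"
  shows "prodfun (v ` {..<d}) l (alternant d v) = 0"
proof -
  let ?\<tau> = "Transposition.transpose a b"
  have \<tau>: "?\<tau> permutes {..<d}" using ab by (auto intro: permutes_swap_id)
  let ?S = "\<lambda>\<sigma>. of_int (sign \<sigma>) * (\<Prod>c<d. l (v c) (\<sigma> c)) :: complex"
  have "?S (\<sigma> \<circ> ?\<tau>) = - ?S \<sigma>" if \<sigma>: "\<sigma> permutes {..<d}" for \<sigma>
  proof -
    have "sign (\<sigma> \<circ> ?\<tau>) = sign \<sigma> * sign ?\<tau>"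
      using \<sigma> \<tau> by (intro sign_compose) (auto simp: permutation_permutes)
    then have s: "sign (\<sigma> \<circ> ?\<tau>) = - sign \<sigma>" using ab by (simp add: sign_swap_id)
    have "(\<Prod>c<d. l (v c) (\<sigma> c)) = (\<Prod>c<d. l (v (?\<tau> c)) (\<sigma> (?\<tau> c)))"
      using prod.permute[OF \<tau>, of "\<lambda>c. l (v c) (\<sigma> c)"] by (simp add: comp_def)
    also have "\<dots> = (\<Prod>c<d. l (v c) (\<sigma> (?\<tau> c)))"
      using ab by (intro prod.cong) (auto simp: Transposition.transpose_def)
    finally show ?thesis by (simp add: s)
  qed
  then have "(\<Sum>\<sigma> | \<sigma> permutes {..<d}. ?S \<sigma>) = (\<Sum>\<sigma> | \<sigma> permutes {..<d}. - ?S \<sigma>)"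
    by (subst sum_permutations_compose_right[OF \<tau>]) (intro sum.cong, auto)
  then have "(\<Sum>\<sigma> | \<sigma> permutes {..<d}. ?S \<sigma>) = 0" by (simp add: sum_negf)
  then show ?thesis by (simp add: prodfun_alternant[OF v])
qed

text \<open>
  The Vandermonde determinant has a nonzero Taylor coefficient with all orders less than
  \<open>d\<close>, at any point: for the orders \<open>0, \<dots>, d - 1\<close> the matrix of the functionals is unipotent
  triangular.
\<close>

lemma taylor_coeff_alternant:
  assumes v: "inj_on v {..<d}" and k: "\<And>a. a < d \<Longrightarrow> k (v a) = a"
  shows "taylor_coeff (v ` {..<d}) x k (alternant d v) = 1"
proof -
  have "of_int (sign \<sigma>) * (\<Prod>a<d. taylor (k (v a)) (x (v a)) (\<sigma> a)) = 0"
    if \<sigma>: "\<sigma> permutes {..<d}" "\<sigma> \<noteq> id" for \<sigma>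
  proof -
    obtain a where "a < d" "\<sigma> a < a"
      using permutes_natset_ge[OF \<sigma>(1)] \<sigma>(2) by fastforce
    then have "taylor (k (v a)) (x (v a)) (\<sigma> a) = 0" by (simp add: k taylor_def)
    then show ?thesis using \<open>a < d\<close> by auto
  qed
  then have "taylor_coeff (v ` {..<d}) x k (alternant d v) =
      (\<Sum>\<sigma>\<in>{id}. of_int (sign \<sigma>) * (\<Prod>a<d. taylor (k (v a)) (x (v a)) (\<sigma> a)))"
    unfolding prodfun_alternant[OF v]
    by (intro sum.mono_neutral_right) (auto simp: permutes_id finite_permutations)
  also have "\<dots> = 1" by (simp add: k taylor_def)
  finally show ?thesis .
qed

section \<open>A polynomial separating two ideals\<close>

lemma enat_sum: "enat (\<Sum>a\<in>A. f a) = (\<Sum>a\<in>A. enat (f a))"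
  by (simp flip: of_nat_eq_enat)

text \<open>
  Let \<open>\<pi>\<close> and \<open>\<rho>\<close> distribute the variables \<open>B\<close> over the parts of \<open>lam\<close> and \<open>mu\<close>.  If no
  compatible map is suitable for \<open>y\<close>, although the weights of the parts of \<open>lam\<close> that meet an
  infinite part of \<open>mu\<close> are large enough and \<open>\<rho>\<close> fills the finite parts of \<open>mu\<close>, then the point of \<open>y\<close> for \<open>\<rho>\<close> is not in the closure
  of the points of \<open>Z\<close> for \<open>\<pi>\<close>.  Indeed, either \<open>\<rho>\<close> does not factor through \<open>\<pi>\<close>, and a
  difference of two variables separates, or the factorization \<open>\<phi>\<close> is compatible.
\<close>

lemma separating_polynomial:
  assumes B: "finite B" and \<pi>: "admissible lam B \<pi>" and \<rho>: "\<rho> \<in> B \<rightarrow> {..<length mu}"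
    and d: "weight_vector mu d"
    and y: "inj_on y {..<length mu}"
    and fin: "\<And>\<beta>. \<beta> < length mu \<Longrightarrow> mu ! \<beta> \<noteq> \<infinity> \<Longrightarrow> mu ! \<beta> \<le> enat (card {i\<in>B. \<rho> i = \<beta>})"
    and inf: "\<And>\<beta>. \<beta> < length mu \<Longrightarrow> mu ! \<beta> = \<infinity> \<Longrightarrow>
      d ! \<beta> \<le> (\<Sum>\<alpha>\<in>{\<alpha>\<in>\<pi> ` {i\<in>B. \<rho> i = \<beta>}. lam ! \<alpha> = \<infinity>}. e ! \<alpha>)"
    and none: "\<And>E \<phi>. compatible lam e mu d E \<phi> \<Longrightarrow>
      multidiagonal E \<phi> y \<notin> zariski E closure_of (coord_proj E ` Z)"
  shows "\<exists>h\<in>polys_in B. (\<forall>z\<in>Z. eval_poly (\<lambda>i. z (\<pi> i)) h = 0) \<and> eval_poly (\<lambda>i. y (\<rho> i)) h \<noteq> 0"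
proof (cases "\<exists>i\<in>B. \<exists>j\<in>B. \<pi> i = \<pi> j \<and> \<rho> i \<noteq> \<rho> j")
  case True
  then obtain i j where ij: "i \<in> B" "j \<in> B" "\<pi> i = \<pi> j" "\<rho> i \<noteq> \<rho> j" by blast
  let ?h = "Var i + Const (- 1) * Var j"
  have "?h \<in> polys_in B"
    using ij by (intro polys_in_add polys_in_mult polys_in_Const polys_in_Var)
  moreover have "y (\<rho> i) \<noteq> y (\<rho> j)"
    using ij \<rho> y by (auto dest!: inj_onD)
  ultimately show ?thesis
    using ij by (intro bexI[of _ ?h]) (auto simp: eval_poly_add eval_poly_mult)
next
  case False
  define E where "E = \<pi> ` B"
  define \<psi> where "\<psi> = inv_into B \<pi>"
  define \<phi> where "\<phi> \<alpha> = \<rho> (\<psi> \<alpha>)" for \<alpha>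
  have \<psi>: "\<psi> \<alpha> \<in> B" "\<pi> (\<psi> \<alpha>) = \<alpha>" if "\<alpha> \<in> E" for \<alpha>
    using that by (auto simp: \<psi>_def E_def inv_into_into f_inv_into_f)
  have \<phi>\<pi>: "\<phi> (\<pi> i) = \<rho> i" if "i \<in> B" for i
  proof -
    have "\<pi> i \<in> E" using that by (simp add: E_def)
    from \<psi>[OF this] False that show ?thesis unfolding \<phi>_def by metis
  qed
  have fib: "{\<alpha>\<in>E. \<phi> \<alpha> = \<beta>} = \<pi> ` {i\<in>B. \<rho> i = \<beta>}" for \<beta>
    using \<phi>\<pi> by (auto simp: E_def)
  have E: "E \<subseteq> {..<length lam}" using \<pi> by (auto simp: E_def admissible_def)
  have "compatible lam e mu d E \<phi>"
    unfolding compatible_def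
  proof (intro conjI allI impI)
    show "E \<subseteq> {..<length lam}" by fact
    show "\<phi> \<in> E \<rightarrow> {..<length mu}" using \<psi> \<rho> by (auto simp: \<phi>_def)
  next
    fix \<beta> assume \<beta>: "\<beta> < length mu" "mu ! \<beta> = \<infinity>"
    have "{\<alpha>\<in>E. \<phi> \<alpha> = \<beta> \<and> lam ! \<alpha> = \<infinity>} = {\<alpha>\<in>\<pi> ` {i\<in>B. \<rho> i = \<beta>}. lam ! \<alpha> = \<infinity>}"
      using fib by blast
    then show "d ! \<beta> \<le> (\<Sum>\<alpha>\<in>{\<alpha>\<in>E. \<phi> \<alpha> = \<beta> \<and> lam ! \<alpha> = \<infinity>}. e ! \<alpha>)"
      using inf[OF \<beta>] by simp
  next
    fix \<beta> assume \<beta>: "\<beta> < length mu"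
    show "mu ! \<beta> \<le> (\<Sum>\<alpha>\<in>{\<alpha>\<in>E. \<phi> \<alpha> = \<beta>}. lam ! \<alpha>)"
      unfolding fib
    proof (cases "mu ! \<beta> = \<infinity>")
      case True
      have "0 < d ! \<beta>" using d \<beta> by (auto simp: weight_vector_def)
      then have "{\<alpha>\<in>\<pi> ` {i\<in>B. \<rho> i = \<beta>}. lam ! \<alpha> = \<infinity>} \<noteq> {}"
        using inf[OF \<beta> True] by (intro notI) (simp only: sum.empty)
      then obtain \<alpha> where \<alpha>: "\<alpha> \<in> \<pi> ` {i\<in>B. \<rho> i = \<beta>}" "lam ! \<alpha> = \<infinity>" by blast
      have "lam ! \<alpha> \<le> (\<Sum>\<alpha>\<in>\<pi> ` {i\<in>B. \<rho> i = \<beta>}. lam ! \<alpha>)"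
        using \<alpha>(1) B by (intro member_le_sum) auto
      then show "mu ! \<beta> \<le> (\<Sum>\<alpha>\<in>\<pi> ` {i\<in>B. \<rho> i = \<beta>}. lam ! \<alpha>)" using \<alpha>(2) by simp
    next
      case False
      let ?F = "{i\<in>B. \<rho> i = \<beta>}"
      have "?F = (\<Union>\<alpha>\<in>\<pi> ` ?F. {i\<in>?F. \<pi> i = \<alpha>})" by blast
      then have le: "card ?F \<le> (\<Sum>\<alpha>\<in>\<pi> ` ?F. card {i\<in>?F. \<pi> i = \<alpha>})"
        using card_UN_le[of "\<pi> ` ?F" "\<lambda>\<alpha>. {i\<in>?F. \<pi> i = \<alpha>}"] B by simp
      note fin[OF \<beta> False]
      also have "enat (card ?F) \<le> (\<Sum>\<alpha>\<in>\<pi> ` ?F. enat (card {i\<in>?F. \<pi> i = \<alpha>}))"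
        unfolding enat_sum[symmetric] enat_ord_simps by (rule le)
      also have "\<dots> \<le> (\<Sum>\<alpha>\<in>\<pi> ` ?F. lam ! \<alpha>)"
      proof (rule sum_mono)
        fix \<alpha> assume "\<alpha> \<in> \<pi> ` ?F"
        then have "enat (card {i\<in>B. \<pi> i = \<alpha>}) \<le> lam ! \<alpha>"
          using \<pi> by (auto simp: admissible_def)
        moreover have "card {i\<in>?F. \<pi> i = \<alpha>} \<le> card {i\<in>B. \<pi> i = \<alpha>}"
          using B by (intro card_mono) auto
        ultimately show "enat (card {i\<in>?F. \<pi> i = \<alpha>}) \<le> lam ! \<alpha>"
          using order_trans enat_ord_simps(1) by blast
      qed
      finally show "mu ! \<beta> \<le> (\<Sum>\<alpha>\<in>\<pi> ` ?F. lam ! \<alpha>)" .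
    qed
  qed
  from none[OF this]
  have "multidiagonal E \<phi> y \<notin> zariski E closure_of (coord_proj E ` Z)" .
  moreover have "coord_proj E ` Z \<subseteq> affine_space E"
    by (auto simp: coord_proj_def affine_space_def)
  moreover have "multidiagonal E \<phi> y \<in> affine_space E"
    by (auto simp: multidiagonal_def affine_space_def)
  ultimately obtain g where g: "g \<in> polys_in E" "\<And>z. z \<in> Z \<Longrightarrow> eval_poly (coord_proj E z) g = 0"
    "eval_poly (multidiagonal E \<phi> y) g \<noteq> 0"
    by (auto simp: closure_of_zariski)
  have "polynomial_map B (\<lambda>x. eval_poly (\<lambda>\<alpha>. x (\<psi> \<alpha>)) g)"
    using \<psi>(1) g(1) by (intro polynomial_map_reindex) auto
  then obtain h where h: "h \<in> polys_in B" "\<And>x. eval_poly (\<lambda>\<alpha>. x (\<psi> \<alpha>)) g = eval_poly x h"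
    by (auto simp: polynomial_map_def)
  have "eval_poly (\<lambda>i. z (\<pi> i)) h = eval_poly (coord_proj E z) g" for z
    unfolding h(2)[symmetric] using \<psi>(2)
    by (intro eval_poly_cong[OF g(1)]) (simp add: coord_proj_def)
  moreover have "eval_poly (\<lambda>i. y (\<rho> i)) h = eval_poly (multidiagonal E \<phi> y) g"
    unfolding h(2)[symmetric]
    by (intro eval_poly_cong[OF g(1)]) (simp add: multidiagonal_def \<phi>_def)
  ultimately show ?thesis using g h(1) by (intro bexI[of _ h]) simp_all
qed

text \<open>
  Of \<open>C + 1\<close> disjoint groups, at least one avoids a given set of at most \<open>C\<close> elements.
\<close>

lemma ex_clean_group:
  assumes "finite X" "card X \<le> C" and "\<And>g g' a a'. g \<le> C \<Longrightarrow> g' \<le> C \<Longrightarrow> v g a = v g' a' \<Longrightarrow> g = g'"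
  shows "\<exists>g\<le>C. \<forall>a<n. v g a \<notin> (X :: 'a set)"
proof (rule ccontr)
  assume "\<not> ?thesis"
  then have "\<forall>g\<in>{..C}. \<exists>a. v g a \<in> X" by (meson atMost_iff)
  then obtain a where a: "\<forall>g\<in>{..C}. v g (a g) \<in> X" by metis
  have "inj_on (\<lambda>g. v g (a g)) {..C}" using assms(3) by (auto intro!: inj_onI)
  then have "card {..C} \<le> card X"
    using a assms(1) by (intro card_inj_on_le) auto
  then show False using assms(2) by simp
qed

text \<open>
  Necessity at a single point \<open>y\<close>.  If there is no suitable map for \<open>y\<close>, a product of
  Vandermonde determinants \<open>F\<close> and of powers of separating polynomials \<open>H\<close> lies in the ideal
  of \<open>Z\<close>, but not in that of \<open>Y\<close>.
\<close>

lemma PP_subset_imp_compatible: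
  assumes lam: "infinity_partition lam" and mu: "infinity_partition mu"
    and e: "weight_vector lam e" and d: "weight_vector mu d"
    and sub: "PP lam e Z \<subseteq> PP mu d Y"
    and y: "y \<in> Y" "inj_on y {..<length mu}"
  shows "\<exists>E \<phi>. compatible lam e mu d E \<phi> \<and>
    multidiagonal E \<phi> y \<in> zariski E closure_of (coord_proj E ` Z)"
proof (rule ccontr)
  assume "\<not> ?thesis"
  then have none: "multidiagonal E \<phi> y \<notin> zariski E closure_of (coord_proj E ` Z)"
    if "compatible lam e mu d E \<phi>" for E \<phi> using that by blast
  \<comment> \<open>\<open>C\<close> bounds the number of indices lying in finite parts of \<open>lam\<close>.\<close>
  define C where "C = (\<Sum>\<alpha> | \<alpha> < length lam \<and> lam ! \<alpha> \<noteq> \<infinity>. the_enat (lam ! \<alpha>))"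
  \<comment> \<open>The variables \<open>B\<close>: as many as its size for each finite part of \<open>mu\<close>, and for each
    infinite part \<open>\<beta>\<close> the variables \<open>v \<beta> g a\<close> in \<open>C + 1\<close> groups \<open>g\<close> of \<open>d ! \<beta>\<close> members \<open>a\<close>.\<close>
  define v where "v \<beta> g a = prod_encode (\<beta>, prod_encode (g, a))" for \<beta> g a
  define K where "K \<beta> = (if mu ! \<beta> = \<infinity> then prod_encode ` ({..C} \<times> {..<d ! \<beta>})
     else {..<the_enat (mu ! \<beta>)})" for \<beta>
  define B where "B = (\<Union>\<beta><length mu. (\<lambda>c. prod_encode (\<beta>, c)) ` K \<beta>)"
  define \<rho> where "\<rho> i = fst (prod_decode i)" for i
  have finK: "finite (K \<beta>)" for \<beta> by (simp add: K_def)
  have B: "finite B" using finK by (auto simp: B_def)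
  have \<rho>: "\<rho> \<in> B \<rightarrow> {..<length mu}" by (auto simp: B_def \<rho>_def)
  have \<rho>_less: "\<rho> i < length mu" if "i \<in> B" for i using \<rho> that by auto
  have v_inj [simp]: "v \<beta> g a = v \<beta>' g' a' \<longleftrightarrow> \<beta> = \<beta>' \<and> g = g' \<and> a = a'" for \<beta> g a \<beta>' g' a'
    by (auto simp: v_def)
  have \<rho>v [simp]: "\<rho> (v \<beta> g a) = \<beta>" for \<beta> g a by (simp add: \<rho>_def v_def)
  have vB: "v \<beta> g a \<in> B" if "\<beta> < length mu" "mu ! \<beta> = \<infinity>" "g \<le> C" "a < d ! \<beta>" for \<beta> g a
  proof -
    have "prod_encode (g, a) \<in> K \<beta>" using that by (simp add: K_def)
    then show ?thesis using that(1) by (auto simp: B_def v_def)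
  qed
  have fin: "enat (card {i\<in>B. \<rho> i = \<beta>}) = mu ! \<beta>" if "\<beta> < length mu" "mu ! \<beta> \<noteq> \<infinity>" for \<beta>
  proof -
    have "{i\<in>B. \<rho> i = \<beta>} = (\<lambda>c. prod_encode (\<beta>, c)) ` K \<beta>"
      using that by (auto simp: B_def \<rho>_def)
    then have "card {i\<in>B. \<rho> i = \<beta>} = card (K \<beta>)"
      by (simp add: card_image inj_on_def)
    then show ?thesis using that by (auto simp: K_def)
  qed
  have adm\<rho>: "admissible mu B \<rho>"
    unfolding admissible_def
  proof (intro conjI allI impI)
    fix \<beta> assume "\<beta> < length mu"
    then show "enat (card {i\<in>B. \<rho> i = \<beta>}) \<le> mu ! \<beta>" using fin by (cases "mu ! \<beta> = \<infinity>") auto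
  qed (use \<rho> in auto)

  define P where "P = {\<beta>. \<beta> < length mu \<and> mu ! \<beta> = \<infinity>} \<times> {..C}"
  define S where "S p = v (fst p) (snd p) ` {..<d ! fst p}" for p
  define D where "D p = alternant (d ! fst p) (v (fst p) (snd p))" for p
  \<comment> \<open>\<open>F\<close> is the product of the Vandermonde determinants of all groups.\<close>
  define F where "F = (\<Prod>p\<in>P. D p)"
  have P: "finite P" by (simp add: P_def)
  have S_disj: "S p \<inter> S q = {}" if "p \<noteq> q" for p q
    using that by (auto simp: S_def prod_eq_iff)
  have SB: "(\<Union>p\<in>P. S p) \<subseteq> B" using vB by (auto simp: S_def P_def)
  have v_inj_on: "inj_on (v \<beta> g) A" for \<beta> g A by (auto simp: inj_on_def)
  have D: "D p \<in> polys_in (S p)" for p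
    by (simp add: D_def S_def alternant_in_polys_in)
  have F: "F \<in> polys_in (\<Union>p\<in>P. S p)"
    unfolding F_def by (intro polys_in_prod) (meson D UN_upper polys_in_mono)
  have prodF: "prodfun B l F = (\<Prod>p\<in>P. prodfun (S p) l (D p)) * (\<Prod>i\<in>B - (\<Union>p\<in>P. S p). l i 0)" for l
    unfolding prodfun_enlarge[OF B SB F] unfolding F_def
    by (subst prodfun_prod_disjoint) (use P D S_disj in \<open>auto simp: S_def\<close>)

  \<comment> \<open>The orders \<open>\<kappa>\<close> below pick one monomial from each determinant: the member \<open>a\<close> of a group
    is differentiated \<open>a\<close> times.\<close>
  have F_nonzero: "\<exists>\<kappa>. (\<forall>i\<in>B. \<kappa> i < d ! \<rho> i) \<and> taylor_coeff B x \<kappa> F \<noteq> 0" for x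
  proof (intro exI conjI ballI)
    define \<kappa> where "\<kappa> i = (if mu ! \<rho> i = \<infinity> then snd (prod_decode (snd (prod_decode i))) else 0)" for i
    have \<kappa>v: "\<kappa> (v \<beta> g a) = a" if "mu ! \<beta> = \<infinity>" for \<beta> g a
      using that by (simp add: \<kappa>_def \<rho>_def v_def)
    have inS: "i \<in> (\<Union>p\<in>P. S p) \<and> \<kappa> i < d ! \<rho> i" if i: "i \<in> B" "mu ! \<rho> i = \<infinity>" for i
    proof -
      from i obtain c where c: "i = prod_encode (\<rho> i, c)" "c \<in> K (\<rho> i)" "\<rho> i < length mu"
        by (auto simp: B_def \<rho>_def)
      then obtain g a where "g \<le> C" "a < d ! \<rho> i" "i = v (\<rho> i) g a"
        using i(2) by (auto simp: K_def v_def)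
      then show ?thesis
        using i(2) c(3) \<kappa>v[of "\<rho> i" g a] by (auto simp: S_def P_def intro!: bexI[of _ "(\<rho> i, g)"])
    qed
    show "\<kappa> i < d ! \<rho> i" if "i \<in> B" for i
    proof (cases "mu ! \<rho> i = \<infinity>")
      case False
      then show ?thesis using d \<rho>_less[OF that] by (auto simp: \<kappa>_def weight_vector_def)
    qed (use inS that in blast)
    have "taylor_coeff (S p) x \<kappa> (D p) = 1" if "p \<in> P" for p
      unfolding S_def D_def
      by (rule taylor_coeff_alternant[OF v_inj_on]) (use that \<kappa>v in \<open>auto simp: P_def\<close>)
    moreover have "taylor (\<kappa> i) (x i) 0 = 1" if "i \<in> B - (\<Union>p\<in>P. S p)" for i
      using inS[of i] that by (auto simp: \<kappa>_def)
    ultimately have "taylor_coeff B x \<kappa> F = 1" by (simp add: prodF)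
    then show "taylor_coeff B x \<kappa> F \<noteq> 0" by simp
  qed

  define good where "good \<pi> \<longleftrightarrow> (\<forall>\<beta><length mu. mu ! \<beta> = \<infinity> \<longrightarrow>
     d ! \<beta> \<le> (\<Sum>\<alpha>\<in>{\<alpha>\<in>\<pi> ` {i\<in>B. \<rho> i = \<beta>}. lam ! \<alpha> = \<infinity>}. e ! \<alpha>))" for \<pi>
  \<comment> \<open>If the infinite parts of \<open>lam\<close> meeting \<open>\<beta>\<close> have too small total weight, a group without
    indices in finite parts has more members than there are pairs of a part and an order,
    so that two members get the same Taylor functional.\<close>
  have F_zero: "taylor_coeff B (\<lambda>i. z (\<pi> i)) k F = 0"
    if \<pi>: "admissible lam B \<pi>" and bad: "\<not> good \<pi>" and k: "\<forall>i\<in>B. k i < e ! \<pi> i" for \<pi> z k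
  proof -
    obtain \<beta> where \<beta>: "\<beta> < length mu" "mu ! \<beta> = \<infinity>"
      and less: "(\<Sum>\<alpha>\<in>{\<alpha>\<in>\<pi> ` {i\<in>B. \<rho> i = \<beta>}. lam ! \<alpha> = \<infinity>}. e ! \<alpha>) < d ! \<beta>"
      using bad by (auto simp: good_def not_le)
    define X where "X = {i\<in>B. lam ! \<pi> i \<noteq> \<infinity>}"
    let ?A = "{\<alpha>. \<alpha> < length lam \<and> lam ! \<alpha> \<noteq> \<infinity>}"
    have "X = (\<Union>\<alpha>\<in>?A. {i\<in>B. \<pi> i = \<alpha>})" using \<pi> by (auto simp: X_def admissible_def)
    then have "card X \<le> (\<Sum>\<alpha>\<in>?A. card {i\<in>B. \<pi> i = \<alpha>})"
      using card_UN_le[of ?A "\<lambda>\<alpha>. {i\<in>B. \<pi> i = \<alpha>}"] by simp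
    also have "\<dots> \<le> C"
      unfolding C_def
    proof (rule sum_mono)
      fix \<alpha> assume "\<alpha> \<in> ?A"
      then have "enat (card {i\<in>B. \<pi> i = \<alpha>}) \<le> lam ! \<alpha>" "lam ! \<alpha> \<noteq> \<infinity>"
        using \<pi> by (auto simp: admissible_def)
      then show "card {i\<in>B. \<pi> i = \<alpha>} \<le> the_enat (lam ! \<alpha>)" by (cases "lam ! \<alpha>") auto
    qed
    finally obtain g where g: "g \<le> C" "\<forall>a<d ! \<beta>. v \<beta> g a \<notin> X"
      using ex_clean_group[of X C "v \<beta>" "d ! \<beta>"] B by (auto simp: X_def)
    let ?T = "SIGMA \<alpha>:{\<alpha>\<in>\<pi> ` {i\<in>B. \<rho> i = \<beta>}. lam ! \<alpha> = \<infinity>}. {..<e ! \<alpha>}"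
    let ?t = "\<lambda>a. (\<pi> (v \<beta> g a), k (v \<beta> g a))"
    have sub: "?t ` {..<d ! \<beta>} \<subseteq> ?T"
    proof (intro image_subsetI)
      fix a assume "a \<in> {..<d ! \<beta>}"
      then have "v \<beta> g a \<in> B" "v \<beta> g a \<notin> X" using vB[OF \<beta> g(1)] g(2) by auto
      then show "?t a \<in> ?T" using k by (auto simp: X_def)
    qed
    have finT: "finite ?T" using B by auto
    have cardT: "card ?T < d ! \<beta>" using less B by simp
    have "\<not> inj_on ?t {..<d ! \<beta>}"
    proof
      assume "inj_on ?t {..<d ! \<beta>}"
      from card_inj_on_le[OF this sub finT] cardT show False by simp
    qed
    then obtain a b where ab: "a < d ! \<beta>" "b < d ! \<beta>" "a \<noteq> b" "?t a = ?t b"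
      by (auto simp: inj_on_def)
    have "taylor_coeff (S (\<beta>, g)) (\<lambda>i. z (\<pi> i)) k (D (\<beta>, g)) = 0"
      unfolding S_def D_def fst_conv snd_conv
      by (rule prodfun_alternant_eq_0[OF v_inj_on ab(1-3)]) (use ab(4) in simp)
    moreover have "(\<beta>, g) \<in> P" using \<beta> g by (simp add: P_def)
    ultimately show ?thesis using P by (auto simp: prodF)
  qed

  define G where "G = {\<pi> \<in> B \<rightarrow>\<^sub>E {..<length lam}. admissible lam B \<pi> \<and> good \<pi>}"
  have G: "finite G" unfolding G_def by (intro finite_subset[OF Collect_restrict] finite_PiE B) auto
  have "\<exists>h\<in>polys_in B. (\<forall>z\<in>Z. eval_poly (\<lambda>i. z (\<pi> i)) h = 0) \<and> eval_poly (\<lambda>i. y (\<rho> i)) h \<noteq> 0"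
    if "\<pi> \<in> G" for \<pi>
    using that fin
    by (intro separating_polynomial[where d = d and e = e and lam = lam and mu = mu] B \<rho> d y none)
      (auto simp: G_def good_def)
  then obtain h where h: "\<And>\<pi>. \<pi> \<in> G \<Longrightarrow> h \<pi> \<in> polys_in B"
      "\<And>\<pi> z. \<pi> \<in> G \<Longrightarrow> z \<in> Z \<Longrightarrow> eval_poly (\<lambda>i. z (\<pi> i)) (h \<pi>) = 0"
      "\<And>\<pi>. \<pi> \<in> G \<Longrightarrow> eval_poly (\<lambda>i. y (\<rho> i)) (h \<pi>) \<noteq> 0"
    by metis
  \<comment> \<open>\<open>M\<close> exceeds the total order of every Taylor coefficient that has to vanish.\<close>
  define M where "M = Suc (\<Sum>i\<in>B. sum_list e)"
  define H where "H = (\<Prod>\<pi>\<in>G. h \<pi> ^ M)"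
  have H: "H \<in> polys_in B" unfolding H_def by (intro polys_in_prod polys_in_power h)
  have FB: "F \<in> polys_in B" using F SB polys_in_mono by blast
  have FH: "F * H \<in> polys_in B" by (intro polys_in_mult FB H)

  have "F * H \<in> PP lam e Z"
    unfolding PP_mem_iff[OF lam e B FH]
  proof (intro allI impI)
    fix \<pi> z and k :: "nat \<Rightarrow> nat"
    assume \<pi>: "admissible lam B \<pi>" and z: "z \<in> Z" and k: "\<forall>i\<in>B. k i < e ! \<pi> i"
    show "taylor_coeff B (\<lambda>i. z (\<pi> i)) k (F * H) = 0"
    proof (cases "good \<pi>")
      case False
      show ?thesis
        by (rule taylor_coeff_mult_eq_0[OF B _ k]) (use F_zero[OF \<pi> False] in blast)
    next
      case True
      let ?\<pi> = "restrict \<pi> B"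
      have "{i\<in>B. ?\<pi> i = \<alpha>} = {i\<in>B. \<pi> i = \<alpha>}" for \<alpha> by auto
      moreover have "?\<pi> ` {i\<in>B. \<rho> i = \<beta>} = \<pi> ` {i\<in>B. \<rho> i = \<beta>}" for \<beta> by auto
      ultimately have \<pi>G: "?\<pi> \<in> G"
        using \<pi> True by (auto simp: G_def admissible_def good_def)
      have 0: "eval_poly (\<lambda>i. z (\<pi> i)) (h ?\<pi>) = 0"
        using h(2)[OF \<pi>G z] eval_poly_cong[OF h(1)[OF \<pi>G], of "\<lambda>i. z (\<pi> i)" "\<lambda>i. z (?\<pi> i)"] by simp
      have "F * H = h ?\<pi> ^ M * (F * (\<Prod>\<pi>\<in>G - {?\<pi>}. h \<pi> ^ M))"
        unfolding H_def prod.remove[OF G \<pi>G] by (simp add: mult_ac)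
      moreover have "taylor_coeff B (\<lambda>i. z (\<pi> i)) k (h ?\<pi> ^ M * (F * (\<Prod>\<pi>\<in>G - {?\<pi>}. h \<pi> ^ M))) = 0"
      proof (rule taylor_coeff_mult_eq_0[OF B _ k])
        fix \<kappa> assume \<kappa>: "\<forall>i\<in>B. \<kappa> i < e ! \<pi> i"
        have "\<kappa> i \<le> sum_list e" if "i \<in> B" for i
        proof -
          have "\<pi> i < length e" using \<pi> e that by (auto simp: admissible_def weight_vector_def)
          then have "e ! \<pi> i \<le> sum_list e" by (simp add: elem_le_sum_list)
          then show ?thesis using \<kappa> that by fastforce
        qed
        then have "(\<Sum>i\<in>B. \<kappa> i) < M" unfolding M_def less_Suc_eq_le by (intro sum_mono)
        then show "taylor_coeff B (\<lambda>i. z (\<pi> i)) \<kappa> (h ?\<pi> ^ M) = 0"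
          by (intro taylor_coeff_power_eq_0 B h \<pi>G 0)
      qed
      ultimately show ?thesis by (simp only:)
    qed
  qed
  then have "F * H \<in> PP mu d Y" using sub by blast
  then have zero: "taylor_coeff B (\<lambda>i. y (\<rho> i)) k (F * H) = 0" if "\<forall>i\<in>B. k i < d ! \<rho> i" for k
    using that adm\<rho> y(1) unfolding PP_mem_iff[OF mu d B FH] by blast
  have "eval_poly (\<lambda>i. y (\<rho> i)) (h \<pi> ^ n) \<noteq> 0" if "\<pi> \<in> G" for \<pi> n
    using h(3)[OF that] by (induction n) (simp_all add: eval_poly_mult)
  then have "eval_poly (\<lambda>i. y (\<rho> i)) H \<noteq> 0"
    using G by (simp add: H_def eval_poly_prod)
  moreover obtain \<kappa> where "\<forall>i\<in>B. \<kappa> i < d ! \<rho> i" "taylor_coeff B (\<lambda>i. y (\<rho> i)) \<kappa> F \<noteq> 0"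
    using F_nonzero[of "\<lambda>i. y (\<rho> i)"] by blast
  ultimately show False
    using taylor_coeff_mult_nonzero[OF B H, of "\<lambda>i. y (\<rho> i)" \<kappa> "\<lambda>i. d ! \<rho> i" F] zero by blast
qed

section \<open>Irreducibility of the smaller variety\<close>

lemma irreducible_space_finite_cover:
  assumes X: "irreducible_space X" and "finite I" and "\<And>i. i \<in> I \<Longrightarrow> closedin X (C i)"
    and "topspace X \<subseteq> (\<Union>i\<in>I. C i)"
  shows "\<exists>i\<in>I. topspace X \<subseteq> C i"
  using assms(2-)
proof (induction I rule: finite_induct)
  case empty
  then show ?case using X by (auto simp: irreducible_space_def)
next
  case (insert i I)
  have cl: "closedin X (C i)" "closedin X (\<Union>i\<in>I. C i)"
    using insert by (auto intro: closedin_Union)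
  then have "C i \<union> (\<Union>i\<in>I. C i) = topspace X"
    using insert.prems(2) closedin_subset[OF cl(1)] closedin_subset[OF cl(2)] by auto
  then consider "C i = topspace X" | "(\<Union>i\<in>I. C i) = topspace X"
    using X cl unfolding irreducible_space_def by blast
  then show ?case
    by cases (use insert in auto)
qed

text \<open>
  The multi-diagonal map is continuous, so the last condition on \<open>Y\<close> is a closed one.
\<close>

lemma closedin_multidiagonal_vimage:
  assumes \<phi>: "\<phi> \<in> E \<rightarrow> A" and S: "S \<subseteq> affine_space E"
  shows "closedin (zariski A) {y \<in> affine_space A. multidiagonal E \<phi> y \<in> zariski E closure_of S}"
    (is "closedin _ ?C")
proof -
  let ?I = "{g\<in>polys_in E. \<forall>s\<in>S. eval_poly s g = 0}"
  have "\<exists>h. h \<in> polys_in A \<and> (\<forall>y. eval_poly (multidiagonal E \<phi> y) g = eval_poly y h)"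
    if "g \<in> ?I" for g
  proof -
    have g: "g \<in> polys_in E" using that by simp
    obtain h where h: "h \<in> polys_in A" "\<And>y. eval_poly (\<lambda>\<alpha>. y (\<phi> \<alpha>)) g = eval_poly y h"
      using polynomial_map_reindex[OF g \<phi>] by (auto simp: polynomial_map_def)
    have "eval_poly (multidiagonal E \<phi> y) g = eval_poly (\<lambda>\<alpha>. y (\<phi> \<alpha>)) g" for y
      by (rule eval_poly_cong[OF g]) (simp add: multidiagonal_def)
    then show ?thesis using h by auto
  qed
  then have "\<forall>g\<in>?I. \<exists>h. h \<in> polys_in A \<and> (\<forall>y. eval_poly (multidiagonal E \<phi> y) g = eval_poly y h)"
    by blast
  from bchoice[OF this] obtain h where h: "\<And>g. g \<in> ?I \<Longrightarrow> h g \<in> polys_in A"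
    "\<And>g y. g \<in> ?I \<Longrightarrow> eval_poly (multidiagonal E \<phi> y) g = eval_poly y (h g)"
    by blast
  have "multidiagonal E \<phi> y \<in> affine_space E" for y
    by (auto simp: multidiagonal_def affine_space_def)
  then have "?C = zero_locus A (h ` ?I)"
    using h(2) by (auto simp: closure_of_zariski[OF S] zero_locus_def)
  then show ?thesis
    unfolding closedin_zariski using h(1) by (intro exI[of _ "h ` ?I"]) auto
qed

theorem theorem1p12:
  fixes lam mu :: "enat list" and e d :: "nat list"
    and Z Y :: "(nat \<Rightarrow> complex) set" and p q :: "cpoly set"
  assumes "infinity_partition lam" and "infinity_partition mu"
    and "reduced_weight lam e" and "reduced_weight mu d"
    and "irreducible_closed_in_distinct_locus (length lam) Z"
    and "irreducible_closed_in_distinct_locus (length mu) Y"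
    and "p = PP lam e Z" and "q = PP mu d Y"
    and "S_prime p" and "S_prime q"
  shows "p \<subseteq> q \<longleftrightarrow>
    (\<exists>E \<phi>. E \<subseteq> {..<length lam} \<and> \<phi> \<in> E \<rightarrow> {..<length mu} \<and>
      (\<forall>\<beta><length mu. mu ! \<beta> \<le> (\<Sum>\<alpha>\<in>{\<alpha>\<in>E. \<phi> \<alpha> = \<beta>}. lam ! \<alpha>)) \<and>
      (\<forall>\<beta><length mu. mu ! \<beta> = \<infinity> \<longrightarrow>
         d ! \<beta> \<le> (\<Sum>\<alpha>\<in>{\<alpha>\<in>E. \<phi> \<alpha> = \<beta> \<and> lam ! \<alpha> = \<infinity>}. e ! \<alpha>)) \<and>
      Y \<subseteq> {y \<in> affine_space {..<length mu}.
             multidiagonal E \<phi> y \<in> zariski E closure_of (coord_proj E ` Z)})"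
proof -
  let ?C = "\<lambda>E \<phi>. {y \<in> affine_space {..<length mu}.
     multidiagonal E \<phi> y \<in> zariski E closure_of (coord_proj E ` Z)}"
  have locus: "topspace (subtopology (zariski {..<n}) (distinct_locus n)) = distinct_locus n" for n
    by (auto simp: distinct_locus_def)
  have Z: "Z \<subseteq> distinct_locus (length lam)" and Y: "Y \<subseteq> distinct_locus (length mu)"
    using assms(5,6) closedin_subset locus unfolding irreducible_closed_in_distinct_locus_def
    by metis+
  let ?X = "subtopology (zariski {..<length mu}) Y"
  have X: "topspace ?X = Y" using Y by (auto simp: distinct_locus_def)
  have irr: "irreducible_space ?X"
    using assms(6) by (simp add: irreducible_closed_in_distinct_locus_def)
  have "p \<subseteq> q \<longleftrightarrow> (\<exists>E \<phi>. compatible lam e mu d E \<phi> \<and> Y \<subseteq> ?C E \<phi>)"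
  proof
    assume "\<exists>E \<phi>. compatible lam e mu d E \<phi> \<and> Y \<subseteq> ?C E \<phi>"
    then obtain E \<phi> where *: "compatible lam e mu d E \<phi>" "Y \<subseteq> ?C E \<phi>" by blast
    show "p \<subseteq> q"
      unfolding assms(7,8)
      by (rule PP_subset_PP[OF assms(1-4) Z *(1)]) (use *(2) in auto)
  next
    assume pq: "p \<subseteq> q"
    \<comment> \<open>Finitely many closed conditions cover \<open>Y\<close>; as \<open>Y\<close> is irreducible, one of them holds on
      all of \<open>Y\<close>.  Taking \<open>\<phi>\<close> extensional makes the choices finite in number.\<close>
    define I where "I = {(E, \<phi>). E \<subseteq> {..<length lam} \<and> \<phi> \<in> E \<rightarrow>\<^sub>E {..<length mu} \<and> compatible lam e mu d E \<phi>}"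
    have "I \<subseteq> (SIGMA E:Pow {..<length lam}. E \<rightarrow>\<^sub>E {..<length mu})" by (auto simp: I_def)
    moreover have "finite (SIGMA E:Pow {..<length lam}. E \<rightarrow>\<^sub>E {..<length mu})"
      by (intro finite_SigmaI finite_PiE) (auto intro: finite_subset)
    ultimately have I: "finite I" by (rule finite_subset)
    have "\<exists>i\<in>I. topspace ?X \<subseteq> Y \<inter> (\<lambda>(E, \<phi>). ?C E \<phi>) i"
    proof (rule irreducible_space_finite_cover[OF irr I])
      fix i assume "i \<in> I"
      then obtain E \<phi> where i: "i = (E, \<phi>)" "\<phi> \<in> E \<rightarrow> {..<length mu}" by (auto simp: I_def PiE_def)
      have "coord_proj E ` Z \<subseteq> affine_space E"
        by (auto simp: coord_proj_def affine_space_def)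
      then show "closedin ?X (Y \<inter> (\<lambda>(E, \<phi>). ?C E \<phi>) i)"
        unfolding i(1) prod.case
        by (intro closedin_subtopology_Int_closed closedin_multidiagonal_vimage i(2))
    next
      show "topspace ?X \<subseteq> (\<Union>i\<in>I. Y \<inter> (\<lambda>(E, \<phi>). ?C E \<phi>) i)"
        unfolding X
      proof
        fix y assume y: "y \<in> Y"
        then have y': "y \<in> affine_space {..<length mu}" "inj_on y {..<length mu}"
          using Y by (auto simp: distinct_locus_def)
        obtain E \<phi> where E: "compatible lam e mu d E \<phi>"
          "multidiagonal E \<phi> y \<in> zariski E closure_of (coord_proj E ` Z)"
          using PP_subset_imp_compatible[OF assms(1,2) _ _ _ y y'(2)] assms(3,4) pq
          unfolding assms(7,8) reduced_weight_def by blast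
        let ?\<phi> = "restrict \<phi> E"
        have "multidiagonal E ?\<phi> y = multidiagonal E \<phi> y"
          by (auto simp: multidiagonal_def)
        moreover have "{\<alpha>\<in>E. ?\<phi> \<alpha> = \<beta>} = {\<alpha>\<in>E. \<phi> \<alpha> = \<beta>}"
          "{\<alpha>\<in>E. ?\<phi> \<alpha> = \<beta> \<and> lam ! \<alpha> = \<infinity>} = {\<alpha>\<in>E. \<phi> \<alpha> = \<beta> \<and> lam ! \<alpha> = \<infinity>}" for \<beta>
          by auto
        moreover from this have "(E, ?\<phi>) \<in> I"
          using E(1) by (auto simp: I_def compatible_def)
        ultimately show "y \<in> (\<Union>i\<in>I. Y \<inter> (\<lambda>(E, \<phi>). ?C E \<phi>) i)"
          using y y'(1) E(2) by (intro UN_I[of "(E, ?\<phi>)"]) auto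
      qed
    qed
    then obtain E \<phi> where "compatible lam e mu d E \<phi>" "Y \<subseteq> ?C E \<phi>"
      unfolding X by (auto simp: I_def)
    then show "\<exists>E \<phi>. compatible lam e mu d E \<phi> \<and> Y \<subseteq> ?C E \<phi>" by blast
  qed
  then show ?thesis by (simp add: compatible_def)
qed

end
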